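(* Let $d\ge 1$, let $(X_t)_{t\ge 0}$ be continuous-time simple random walk on $\mathbb{Z}^d$ started at the origin, and let $T\mapsto\alpha_T\in(0,\infty)$ satisfy $$1\ll\alpha_T\ll\Big(\frac{T}{\log T}\Big)^{\frac1{d+2}}\qquad\text{as }T\to\infty.$$ Fix $R>0$, denote $Q_R=[-R,R]^d$ and fix a measurable function $F\colon M_1(Q_R)\to\mathbb{R}$. Introduce $$\chi=\inf\Big\{\tfrac12\|\nabla g\|_2^2-F(g^2)\colon g\in H^1(\mathbb{R}^d),\ \|g\|_2=1,\ \operatorname{supp}(g)\subseteq Q_R\Big\}.$$ Then $$\limsup_{T\to\infty}\frac{\alpha_T^2}{T}\log\mathbb{E}\Big[\exp\Big\{\frac{T}{\alpha_T^2}F(L_T)\Big\}\mathbf{1}_{\{\operatorname{supp}(L_T)\subseteq Q_R\}}\Big]\le-\chi,$$ provided that $$\liminf_{T\uparrow\infty}\ \inf_{\mu\in\mathcal{M}_1(B_{R\alpha_T})}\Big(\alpha_T^2\,\tfrac12\sum_{x\sim y}\big(\sqrt{\mu(x)}-\sqrt{\mu(y)}\big)^2-F\big(\alpha_T^d\,\mu(\lfloor\,\cdot\,\alpha_T\rfloor)\big)\Big)\ge\chi.$$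
   Context: $f\ll g$ means $f/g\to 0$ as $T\to\infty$ (so $1\ll\alpha_T$ means $\alpha_T\to\infty$). Continuous-time simple random walk on $\mathbb{Z}^d$ is the Markov chain whose generator is the lattice Laplacian: $A_{x,y}=1$ if $|x-y|=1$, $A_{x,x}=-2d$, and $A_{x,y}=0$ otherwise. $\mathbb{E}$ is expectation for the walk started at $0$. Local times: $\ell_T(x)=\int_0^T\mathbf{1}_{\{X_s=x\}}\,\mathrm{d}s$, $x\in\mathbb{Z}^d$. Rescaled local times: $$L_T(x)=\frac{\alpha_T^d}{T}\,\ell_T\big(\lfloor\alpha_Tx\rfloor\big),\qquad x\in\mathbb{R}^d,$$ with the floor taken coordinatewise; $L_T$ is a random step function and a probability density on $\mathbb{R}^d$. For a cube $Q\subset\mathbb{R}^d$, $M_1(Q)$ is the set of all probability densities $Q\to[0,\infty)$ (identified with their extension by $0$ to $\mathbb{R}^d$), measurability referring to the topology induced by test integrals against bounded continuous functions. $B_{R\alpha_T}=[-R\alpha_T,R\alpha_T]^d\cap\mathbb{Z}^d$, and $\mathcal{M}_1(B_{R\alpha_T})$ is the set of probability measures on it, extended by $0$ to $\mathbb{Z}^d$. The infimum in the condition is over those $\mu\in\mathcal{M}_1(B_{R\alpha_T})$ for which the step function $x\mapsto\alpha_T^d\,\mu(\lfloor x\alpha_T\rfloor)$ (floor coordinatewise) is supported in $Q_R$, so that $F$ is defined there. The sum $\sum_{x\sim y}$ runs over ordered pairs of nearest neighbours $x,y\in\mathbb{Z}^d$, so that $\frac12\sum_{x\sim y}(\sqrt{\mu(x)}-\sqrt{\mu(y)})^2=-\sum_{x,y}A_{x,y}\sqrt{\mu(x)}\sqrt{\mu(y)}$.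 *)

theory Defs
  imports "HOL-Probability.Probability"
begin

section \<open>Asymptotic comparison and logarithm\<close>

definition much_less :: "(real \<Rightarrow> real) \<Rightarrow> (real \<Rightarrow> real) \<Rightarrow> bool" where
  "much_less f g \<longleftrightarrow> ((\<lambda>T. f T / g T) \<longlongrightarrow> 0) at_top"

text \<open>Expectations of nonnegative variables are taken in \<^typ>\<open>ennreal\<close>, since they may be infinite.\<close>

definition log_ennreal :: "ennreal \<Rightarrow> ereal" where
  "log_ennreal x =
     (if x = 0 then -\<infinity> else if x = \<infinity> then \<infinity> else ereal (ln (enn2real x)))"


section \<open>Continuous-time simple random walk\<close>

text \<open>The integer lattice is \<^typ>\<open>int ^ 'd\<close>, with dimension \<open>CARD('d)\<close>.\<close>

definition neighbours :: "int ^ 'd \<Rightarrow> int ^ 'd \<Rightarrow> bool" where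
  "neighbours x y \<longleftrightarrow> norm (\<chi> i. real_of_int (x $ i - y $ i)) = 1"

definition lattice_laplacian :: "int ^ 'd \<Rightarrow> int ^ 'd \<Rightarrow> real" where
  "lattice_laplacian x y =
     (if neighbours x y then 1 else if x = y then - 2 * real CARD('d) else 0)"

definition transition_function :: "(real \<Rightarrow> 's \<Rightarrow> 's \<Rightarrow> real) \<Rightarrow> bool" where
  "transition_function p \<longleftrightarrow>
     (\<forall>t\<ge>0. \<forall>x y. 0 \<le> p t x y) \<and>
     (\<forall>t\<ge>0. \<forall>x. ((\<lambda>y. p t x y) has_sum 1) UNIV) \<and>
     (\<forall>x y. p 0 x y = of_bool (x = y)) \<and>
     (\<forall>s\<ge>0. \<forall>t\<ge>0. \<forall>x y. ((\<lambda>z. p s x z * p t z y) has_sum p (s + t) x y) UNIV)"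

definition has_generator :: "(real \<Rightarrow> 's \<Rightarrow> 's \<Rightarrow> real) \<Rightarrow> ('s \<Rightarrow> 's \<Rightarrow> real) \<Rightarrow> bool" where
  "has_generator p A \<longleftrightarrow>
     (\<forall>x y. ((\<lambda>t. p t x y) has_real_derivative A x y) (at 0 within {0..}))"

text \<open>
  The Markov property is expressed by the finite-dimensional distributions. Right-continuity is
  with respect to the discrete topology on the state space.
\<close>

definition markov_chain ::
    "'w measure \<Rightarrow> ('s \<Rightarrow> 's \<Rightarrow> real) \<Rightarrow> 's \<Rightarrow> (real \<Rightarrow> 'w \<Rightarrow> 's) \<Rightarrow> bool" where
  "markov_chain M A x0 X \<longleftrightarrow>
     prob_space M \<and>
     (\<forall>t\<ge>0. X t \<in> M \<rightarrow>\<^sub>M count_space UNIV) \<and>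
     (\<forall>\<omega>\<in>space M. \<forall>t\<ge>0. eventually (\<lambda>s. X s \<omega> = X t \<omega>) (at_right t)) \<and>
     (\<exists>p. transition_function p \<and> has_generator p A \<and>
       (\<forall>n t x. t 0 = 0 \<and> (\<forall>i<n. t i \<le> t (Suc i)) \<longrightarrow>
          measure M {\<omega> \<in> space M. \<forall>i\<le>n. X (t i) \<omega> = x i} =
          of_bool (x 0 = x0) * (\<Prod>i<n. p (t (Suc i) - t i) (x i) (x (Suc i)))))"

definition simple_random_walk :: "'w measure \<Rightarrow> (real \<Rightarrow> 'w \<Rightarrow> int ^ 'd) \<Rightarrow> bool" where
  "simple_random_walk M X \<longleftrightarrow> markov_chain M lattice_laplacian 0 X"


section \<open>Local times\<close>

definition local_time :: "(real \<Rightarrow> 'w \<Rightarrow> 's) \<Rightarrow> real \<Rightarrow> 'w \<Rightarrow> 's \<Rightarrow> real" where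
  "local_time X T \<omega> x = (LBINT s:{0..T}. indicator {x} (X s \<omega>))"

definition lattice_floor :: "real ^ 'd \<Rightarrow> int ^ 'd" where
  "lattice_floor x = (\<chi> i. \<lfloor>x $ i\<rfloor>)"

text \<open>The argument \<open>a\<close> is the value of the scale function at time \<open>T\<close>.\<close>

definition rescaled_local_time ::
    "(real \<Rightarrow> 'w \<Rightarrow> int ^ 'd) \<Rightarrow> real \<Rightarrow> real \<Rightarrow> 'w \<Rightarrow> real ^ 'd \<Rightarrow> real" where
  "rescaled_local_time X a T \<omega> x =
     a ^ CARD('d) / T * local_time X T \<omega> (lattice_floor (a *\<^sub>R x))"

definition supp :: "('a::topological_space \<Rightarrow> 'b::zero) \<Rightarrow> 'a set" where
  "supp f = closure {x. f x \<noteq> 0}"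

definition cube :: "real \<Rightarrow> (real ^ 'd) set" where
  "cube R = {x. \<forall>i. -R \<le> x $ i \<and> x $ i \<le> R}"


section \<open>Probability densities\<close>

text \<open>
  Densities are functions rather than classes modulo null sets. The topology below does not
  separate densities that agree almost everywhere, so neither does its Borel sigma-algebra, and a
  measurable real-valued functional on densities is automatically invariant under changes on null
  sets.
\<close>

definition densities :: "(real ^ 'd) set \<Rightarrow> (real ^ 'd \<Rightarrow> real) set" where
  "densities Q = {f. f \<in> borel_measurable lborel \<and> (\<forall>x. 0 \<le> f x) \<and>
     (\<forall>x. x \<notin> Q \<longrightarrow> f x = 0) \<and> integrable lborel f \<and> (LINT x|lborel. f x) = 1}"

definition density_topology :: "(real ^ 'd) set \<Rightarrow> (real ^ 'd \<Rightarrow> real) topology" where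
  "density_topology Q = topology_generated_by
     {{f \<in> densities Q. (LINT x|lborel. f x * \<phi> x) \<in> U} | \<phi> U.
        continuous_on UNIV \<phi> \<and> bounded (range \<phi>) \<and> open U}"

definition density_space :: "(real ^ 'd) set \<Rightarrow> (real ^ 'd \<Rightarrow> real) measure" where
  "density_space Q = sigma (densities Q) {U. openin (density_topology Q) U}"


section \<open>The Sobolev space and the variational formula\<close>

definition partial_deriv :: "'d \<Rightarrow> (real ^ 'd \<Rightarrow> real) \<Rightarrow> real ^ 'd \<Rightarrow> real" where
  "partial_deriv i f x = frechet_derivative f (at x) (axis i 1)"

text \<open>Smoothness: all iterated partial derivatives exist and are differentiable.\<close>

definition test_function :: "(real ^ 'd \<Rightarrow> real) \<Rightarrow> bool" where
  "test_function \<phi> \<longleftrightarrow>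
     (\<forall>js. foldr partial_deriv js \<phi> differentiable_on UNIV) \<and> compact (supp \<phi>)"

definition L2 :: "(real ^ 'd \<Rightarrow> 'b::euclidean_space) set" where
  "L2 = {f. f \<in> borel_measurable lborel \<and> integrable lborel (\<lambda>x. (norm (f x))\<^sup>2)}"

definition L2_norm :: "(real ^ 'd \<Rightarrow> 'b::euclidean_space) \<Rightarrow> real" where
  "L2_norm f = sqrt (LINT x|lborel. (norm (f x))\<^sup>2)"

definition has_weak_gradient :: "(real ^ 'd \<Rightarrow> real) \<Rightarrow> (real ^ 'd \<Rightarrow> real ^ 'd) \<Rightarrow> bool" where
  "has_weak_gradient g G \<longleftrightarrow>
     (\<forall>\<phi> i. test_function \<phi> \<longrightarrow>
        (LINT x|lborel. g x * partial_deriv i \<phi> x) = - (LINT x|lborel. G x $ i * \<phi> x))"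

definition H1 :: "(real ^ 'd \<Rightarrow> real) set" where
  "H1 = {g \<in> L2. \<exists>G\<in>L2. has_weak_gradient g G}"

text \<open>The choice is unique up to null sets, so the norm of the gradient does not depend on it.\<close>

definition weak_gradient :: "(real ^ 'd \<Rightarrow> real) \<Rightarrow> real ^ 'd \<Rightarrow> real ^ 'd" where
  "weak_gradient g = (SOME G. G \<in> L2 \<and> has_weak_gradient g G)"

text \<open>
  Here \<open>g\<close> runs over representatives of Sobolev classes. For closed \<open>Q\<close>, a class has essential
  support in \<open>Q\<close> iff some representative \<open>g\<close> has \<open>supp g \<subseteq> Q\<close>, and then the square of \<open>g\<close> lies in
  \<open>densities Q\<close> when \<open>g\<close> is normalised. The infimum may be \<open>-\<infinity>\<close>.
\<close>

definition variational_rate :: "(real ^ 'd) set \<Rightarrow> ((real ^ 'd \<Rightarrow> real) \<Rightarrow> real) \<Rightarrow> ereal" where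
  "variational_rate Q F =
     (INF g \<in> {g \<in> H1. L2_norm g = 1 \<and> supp g \<subseteq> Q}.
        ereal (1/2 * (L2_norm (weak_gradient g))\<^sup>2 - F (\<lambda>x. (g x)\<^sup>2)))"


section \<open>The discrete variational problem\<close>

definition lattice_box :: "real \<Rightarrow> (int ^ 'd) set" where
  "lattice_box r = {x. \<forall>i. -r \<le> real_of_int (x $ i) \<and> real_of_int (x $ i) \<le> r}"

text \<open>
  The sum runs over ordered pairs; only finitely many terms are nonzero for finitely supported
  measures.
\<close>

definition discrete_energy :: "(int ^ 'd) pmf \<Rightarrow> real" where
  "discrete_energy \<mu> =
     1/2 * (\<Sum>\<^sub>\<infinity>(x, y) \<in> {(x, y). neighbours x y}. (sqrt (pmf \<mu> x) - sqrt (pmf \<mu> y))\<^sup>2)"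

definition step_density :: "real \<Rightarrow> (int ^ 'd) pmf \<Rightarrow> real ^ 'd \<Rightarrow> real" where
  "step_density a \<mu> x = a ^ CARD('d) * pmf \<mu> (lattice_floor (a *\<^sub>R x))"

definition discrete_rate ::
    "real \<Rightarrow> real \<Rightarrow> ((real ^ 'd \<Rightarrow> real) \<Rightarrow> real) \<Rightarrow> ereal" where
  "discrete_rate R a F =
     (INF \<mu> \<in> {\<mu>. set_pmf \<mu> \<subseteq> lattice_box (R * a) \<and> supp (step_density a \<mu>) \<subseteq> cube R}.
        ereal (a\<^sup>2 * discrete_energy \<mu> - F (step_density a \<mu>)))"

end

theory Submission
  imports Defs
begin

text \<open>
  The heart of the matter is that the normalised local times \<open>\<mu> = local_time X T \<omega> / T\<close> satisfy
  \<open>E [exp (T * I(\<mu>)); the walk stays in S before time T] \<le> exp (O(card S * ln T))\<close> for finite \<open>S\<close>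
  and large \<open>T\<close>,
  where \<open>I\<close> is the Donsker--Varadhan rate function, here the lattice Dirichlet form of
  \<open>sqrt \<mu>\<close> (\<open>exponential_energy_bound\<close>). Informally, the law of \<open>\<mu>\<close> is at most \<open>exp (- T * I(\<mu>))\<close>
  up to a factor that is negligible at the present scale.

  Given this, the theorem follows path by path. If the rescaled local time is supported in the
  cube, then \<open>\<mu>\<close> lives on a box \<open>S\<close> with at most of order \<open>\<alpha> ^ d\<close> sites and is admissible in the
  discrete variational problem, so
  \<open>T / \<alpha>\<^sup>2 * F \<le> T * I(\<mu>) - T / \<alpha>\<^sup>2 * discrete_rate\<close> (\<open>expectation_bound\<close>). After
  taking logarithms and multiplying by \<open>\<alpha>\<^sup>2 / T\<close>, the error is of order \<open>\<alpha> ^ (d + 2) * ln T / T\<close>,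
  which tends to \<open>0\<close> by the upper bound on the scale, and the limit of the discrete rates is
  controlled by hypothesis.

  The exponential bound comes from covering. For a positive function \<open>u\<close> on \<open>S\<close> put
  \<open>V = - A u / u\<close>; the Feynman--Kac bound \<open>feynman_kac_bound\<close> gives
  \<open>E [exp (T * \<Sum> \<mu> V)] \<le> u 0 / min u\<close> on the event of staying in \<open>S\<close>. If \<open>u\<close> is slightly larger than
  \<open>sqrt \<mu>\<close>, then \<open>I(\<mu>) \<le> \<Sum> \<mu> V\<close> up to a small error (\<open>dirichlet_form_le_potential\<close>). Since \<open>\<mu>\<close> is
  random, one uses a grid of functions \<open>u\<close> with polynomially small mesh and sums over it: the number
  of grid points is only \<open>exp (O(card S * ln T))\<close>. Only \<open>u\<close> is discretised, never the argument of \<open>F\<close>: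
  \<open>F\<close> is compared with \<open>I(\<mu>)\<close> at the actual \<open>\<mu>\<close>.
\<close>

section \<open>Local times as limits of grid sums\<close>

text \<open>
  The grid sums evaluate \<open>f\<close> at right end points. Each \<open>s\<close> is therefore approached strictly from the
  right, where \<open>f\<close> converges to \<open>f s\<close>, and dominated convergence applies.
  The same approximation by step functions shows that \<open>f\<close> is measurable. The last grid point, \<open>T\<close>
  itself, is left out of the sum, so that only values of \<open>f\<close> on \<open>[0, T)\<close> enter: a walk that stays
  in a set before time \<open>T\<close> may leave it exactly at time \<open>T\<close>.
\<close>

lemma riemann_sum_right_continuous:
  fixes f :: "real \<Rightarrow> real"
  assumes T: "0 < T"
    and rc: "\<And>s. 0 \<le> s \<Longrightarrow> s < T \<Longrightarrow> (f \<longlongrightarrow> f s) (at_right s)"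
    and bd: "\<And>s. 0 \<le> s \<Longrightarrow> s \<le> T \<Longrightarrow> \<bar>f s\<bar> \<le> B"
  shows "set_integrable lborel {0..T} f" (is ?int)
    and "(\<lambda>n. \<Sum>i<n. T / real (Suc n) * f (real (Suc i) * (T / real (Suc n))))
           \<longlonglongrightarrow> (LBINT s:{0..T}. f s)" (is ?lim)
proof -
  define h where "h n = T / real (Suc n)" for n
  have h: "0 < h n" "real (Suc n) * h n = T" for n
    using T by (auto simp: h_def)
  \<comment> \<open>the first grid point strictly to the right of \<open>s\<close>\<close>
  define \<tau> where "\<tau> n s = real (Suc (nat \<lfloor>s / h n\<rfloor>)) * h n" for n s
  define g where "g n s = (\<Sum>i<n. indicator {real i * h n ..< real (Suc i) * h n} s *
                                    f (real (Suc i) * h n))" for n s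
  have g_eq: "g n s = (if nat \<lfloor>s / h n\<rfloor> < n then f (\<tau> n s) else 0)" if "0 \<le> s" for n s
  proof -
    have "(s \<in> {real i * h n ..< real (Suc i) * h n}) \<longleftrightarrow> i = nat \<lfloor>s / h n\<rfloor>" for i
    proof -
      have "(s \<in> {real i * h n ..< real (Suc i) * h n}) \<longleftrightarrow> real i \<le> s / h n \<and> s / h n < real i + 1"
        using h(1)[of n] by (auto simp: field_simps)
      also have "\<dots> \<longleftrightarrow> \<lfloor>s / h n\<rfloor> = int i"
        by (auto simp: floor_eq_iff)
      also have "\<dots> \<longleftrightarrow> i = nat \<lfloor>s / h n\<rfloor>"
        using that h(1)[of n] by (auto simp: nat_eq_iff2)
      finally show ?thesis .
    qed
    then have "g n s = (\<Sum>i<n. if i = nat \<lfloor>s / h n\<rfloor> then f (real (Suc i) * h n) else 0)"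
      unfolding g_def by (intro sum.cong) (auto simp: indicator_def)
    then show ?thesis by (simp add: \<tau>_def)
  qed
  have g_neg: "g n s = 0" if "s < 0" for n s
    unfolding g_def
    using that h(1)[of n] by (intro sum.neutral) (auto simp: indicator_def mult_less_0_iff dest: order.strict_trans1)
  have tau: "s < \<tau> n s" "\<tau> n s \<le> s + h n" if "0 \<le> s" for n s
  proof -
    have "real (nat \<lfloor>s / h n\<rfloor>) = of_int \<lfloor>s / h n\<rfloor>"
      using that h(1)[of n] by simp
    moreover have "of_int \<lfloor>s / h n\<rfloor> \<le> s / h n" "s / h n < of_int \<lfloor>s / h n\<rfloor> + 1" by linarith+
    ultimately have "real (nat \<lfloor>s / h n\<rfloor>) \<le> s / h n" "s / h n < real (nat \<lfloor>s / h n\<rfloor>) + 1"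
      by simp_all
    then have "real (nat \<lfloor>s / h n\<rfloor>) * h n \<le> s" "s < (real (nat \<lfloor>s / h n\<rfloor>) + 1) * h n"
      by (simp_all only: pos_le_divide_eq[OF h(1)] pos_divide_less_eq[OF h(1)])
    then show "s < \<tau> n s" "\<tau> n s \<le> s + h n"
      by (auto simp: \<tau>_def algebra_simps)
  qed
  have small: "nat \<lfloor>s / h n\<rfloor> < n \<longleftrightarrow> \<tau> n s < T" if "0 \<le> s" for n s
  proof -
    have "\<tau> n s < T \<longleftrightarrow> real (Suc (nat \<lfloor>s / h n\<rfloor>)) * h n < real (Suc n) * h n"
      unfolding \<tau>_def h(2) ..
    also have "\<dots> \<longleftrightarrow> nat \<lfloor>s / h n\<rfloor> < n" using h(1)[of n] by simp
    finally show ?thesis by simp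
  qed
  have h0: "h \<longlonglongrightarrow> 0"
    unfolding h_def by (rule LIMSEQ_Suc, rule lim_const_over_n)
  have conv: "(\<lambda>n. g n s) \<longlonglongrightarrow> f s" if s: "0 \<le> s" "s < T" for s
  proof -
    have "(\<lambda>n. s + h n) \<longlonglongrightarrow> s" using tendsto_add[OF tendsto_const h0, of s] by simp
    then have lim: "(\<lambda>n. \<tau> n s) \<longlonglongrightarrow> s"
      using tau[OF s(1)]
      by (intro tendsto_sandwich[OF _ _ tendsto_const, of s "\<lambda>n. \<tau> n s" _ "\<lambda>n. s + h n"])
         (auto intro!: always_eventually less_imp_le)
    have "filterlim (\<lambda>n. \<tau> n s) (at_right s) sequentially"
      unfolding filterlim_at using lim tau(1)[OF s(1)] less_irrefl
      by (auto intro!: always_eventually) (metis less_irrefl)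
    then have "(\<lambda>n. f (\<tau> n s)) \<longlonglongrightarrow> f s"
      using rc[OF s] by (rule filterlim_compose[rotated])
    moreover have "eventually (\<lambda>n. \<tau> n s < T) sequentially"
      using order_tendstoD(2)[OF lim s(2)] .
    then have "eventually (\<lambda>n. f (\<tau> n s) = g n s) sequentially"
      by eventually_elim (simp add: g_eq s small)
    ultimately show ?thesis by (rule Lim_transform_eventually)
  qed
  have B: "0 \<le> B" using bd[of 0] T by auto
  have g_bound: "\<bar>g n s\<bar> \<le> B * indicator {0..T} s" for n s
  proof (cases "s < 0")
    case False
    then have "s \<le> T" if "\<tau> n s < T" using tau(1)[of s n] that by auto
    then show ?thesis
      using False B bd[of "\<tau> n s"] tau(1)[of s n] by (auto simp: g_eq small indicator_def)
  qed (use g_neg in auto)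
  have g_meas [measurable]: "g n \<in> borel_measurable lborel" for n
    unfolding g_def by measurable
  have lim0: "(\<lambda>n. indicator {0..<T} s * g n s) \<longlonglongrightarrow> indicator {0..<T} s * f s" for s
    using conv[of s] by (auto simp: indicator_def)
  have "(\<lambda>s. indicator {0..<T} s * f s) \<in> borel_measurable lborel"
    by (rule borel_measurable_LIMSEQ_real[OF lim0]) measurable
  then have "(\<lambda>s. indicator {0..<T} s * f s + indicator {T} s * f T) \<in> borel_measurable lborel"
    by measurable
  also have "(\<lambda>s. indicator {0..<T} s * f s + indicator {T} s * f T) = (\<lambda>s. indicator {0..T} s *\<^sub>R f s)"
    using T by (auto simp: indicator_def fun_eq_iff)
  finally have meas [measurable]: "(\<lambda>s. indicator {0..T} s *\<^sub>R f s) \<in> borel_measurable lborel" .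
  have ae: "AE s in lborel. (\<lambda>n. g n s) \<longlonglongrightarrow> indicator {0..T} s *\<^sub>R f s"
    using AE_lborel_singleton[of T]
  proof eventually_elim
    case (elim s)
    consider "s < 0" | "0 \<le> s \<and> s < T" | "T < s" using elim by linarith
    then show ?case
    proof cases
      case 3
      then have "g n s = 0" for n using g_bound[of n s] by auto
      then show ?thesis using 3 by auto
    qed (use conv g_neg in auto)
  qed
  have int: "integrable lborel (\<lambda>s. B * indicator {0..T} s)"
    by (intro integrable_mult_right integrable_real_indicator) (use T in auto)
  note dc = meas g_meas int ae
  show ?int
    unfolding set_integrable_def
    by (rule integrable_dominated_convergence[OF dc]) (use g_bound in auto)
  have "(\<lambda>n. integral\<^sup>L lborel (g n)) \<longlonglongrightarrow> (\<integral>s. indicator {0..T} s *\<^sub>R f s \<partial>lborel)"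
    by (rule integral_dominated_convergence[OF dc]) (use g_bound in auto)
  moreover have "integral\<^sup>L lborel (g n) = (\<Sum>i<n. h n * f (real (Suc i) * h n))" for n
  proof -
    have "integral\<^sup>L lborel (g n) =
        (\<Sum>i<n. (LINT s|lborel. indicator {real i * h n ..< real (Suc i) * h n} s *
                                    f (real (Suc i) * h n)))"
      unfolding g_def by (rule Bochner_Integration.integral_sum) (use h(1)[of n] in \<open>auto intro!: integrable_mult_left simp: mult_right_mono\<close>)
    also have "\<dots> = (\<Sum>i<n. h n * f (real (Suc i) * h n))"
      using h(1)[of n] by (intro sum.cong) (auto simp: algebra_simps)
    finally show ?thesis .
  qed
  ultimately show ?lim
    unfolding h_def set_lebesgue_integral_def by simp
qed

lemma
  assumes T: "0 < T"
    and rc: "\<And>t. 0 \<le> t \<Longrightarrow> eventually (\<lambda>s. X s \<omega> = X t \<omega>) (at_right t)"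
  shows local_time_integrable: "set_integrable lborel {0..T} (\<lambda>s. indicator {x} (X s \<omega>) :: real)"
    and local_time_riemann_sum:
      "(\<lambda>n. \<Sum>i<n. T / real (Suc n) * indicator {x} (X (real (Suc i) * (T / real (Suc n))) \<omega>))
        \<longlonglongrightarrow> local_time X T \<omega> x"
proof -
  have rc': "((\<lambda>s. indicator {x} (X s \<omega>) :: real) \<longlongrightarrow> indicator {x} (X s \<omega>)) (at_right s)"
    if "0 \<le> s" for s
    by (rule tendsto_eventually) (use rc[OF that] in eventually_elim, simp)
  have bd: "\<bar>indicator {x} (X s \<omega>)\<bar> \<le> (1::real)" for s
    by (simp add: indicator_def)
  show "set_integrable lborel {0..T} (\<lambda>s. indicator {x} (X s \<omega>) :: real)"
    by (rule riemann_sum_right_continuous(1)[OF T rc' bd])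
  show "(\<lambda>n. \<Sum>i<n. T / real (Suc n) * indicator {x} (X (real (Suc i) * (T / real (Suc n))) \<omega>))
        \<longlonglongrightarrow> local_time X T \<omega> x"
    unfolding local_time_def
    by (rule riemann_sum_right_continuous(2)[OF T rc' bd])
qed

lemma local_time_nonneg: "0 \<le> local_time X T \<omega> x"
  unfolding local_time_def set_lebesgue_integral_def by (rule integral_nonneg_AE) simp

lemma sum_mult_indicator_singleton:
  assumes "finite S" "z \<in> S"
  shows "(\<Sum>x\<in>S. c * indicator {x} z) = (c::real)"
proof -
  have "(\<Sum>x\<in>S. c * indicator {x} z) = (\<Sum>x\<in>S. if x = z then c else 0)"
    by (intro sum.cong) (auto simp: indicator_def)
  then show ?thesis using assms by simp
qed

lemma grid_less:
  assumes "0 < (T::real)" "i < n"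
  shows "real (Suc i) * (T / real (Suc n)) < T"
  using assms by (simp add: field_simps)

lemma sum_local_time:
  assumes T: "0 < T"
    and rc: "\<And>t. 0 \<le> t \<Longrightarrow> eventually (\<lambda>s. X s \<omega> = X t \<omega>) (at_right t)"
    and fin: "finite S" and stay: "\<And>s. 0 \<le> s \<Longrightarrow> s < T \<Longrightarrow> X s \<omega> \<in> S"
  shows "(\<Sum>x\<in>S. local_time X T \<omega> x) = T"
proof -
  have eq: "(\<Sum>x\<in>S. \<Sum>i<n. T / real (Suc n) * indicator {x} (X (real (Suc i) * (T / real (Suc n))) \<omega>))
      = T - T / real (Suc n)" for n
  proof -
    have "(\<Sum>x\<in>S. \<Sum>i<n. T / real (Suc n) * indicator {x} (X (real (Suc i) * (T / real (Suc n))) \<omega>))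
       = (\<Sum>i<n. \<Sum>x\<in>S. T / real (Suc n) * indicator {x} (X (real (Suc i) * (T / real (Suc n))) \<omega>))"
      by (rule sum.swap)
    also have "\<dots> = (\<Sum>i<n. T / real (Suc n))"
    proof (rule sum.cong)
      fix i assume "i \<in> {..<n}"
      then have "X (real (Suc i) * (T / real (Suc n))) \<omega> \<in> S"
        using grid_less[OF T, of i n] T by (intro stay) auto
      then show "(\<Sum>x\<in>S. T / real (Suc n) * indicator {x} (X (real (Suc i) * (T / real (Suc n))) \<omega>))
          = T / real (Suc n)"
        by (rule sum_mult_indicator_singleton[OF fin])
    qed simp
    also have "\<dots> = T - T / real (Suc n)" by (simp add: field_simps)
    finally show ?thesis .
  qed
  have lim: "(\<lambda>n. T / real (Suc n)) \<longlonglongrightarrow> 0"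
    by (rule LIMSEQ_Suc, rule lim_const_over_n)
  have "(\<lambda>n. T - T / real (Suc n)) \<longlonglongrightarrow> T"
    using tendsto_diff[OF tendsto_const lim, of T] by simp
  moreover have "(\<lambda>n. \<Sum>x\<in>S. \<Sum>i<n. T / real (Suc n) *
      indicator {x} (X (real (Suc i) * (T / real (Suc n))) \<omega>)) \<longlonglongrightarrow> (\<Sum>x\<in>S. local_time X T \<omega> x)"
    by (intro tendsto_sum local_time_riemann_sum[of T X \<omega>, OF T rc])
  ultimately show ?thesis unfolding eq by (rule LIMSEQ_unique[rotated])
qed

text \<open>
  A path that reaches a site stays there for a positive time. Hence a walk whose local times live
  on \<open>S\<close> never leaves \<open>S\<close> before time \<open>T\<close>.
\<close>

lemma local_time_pos:
  assumes s: "0 \<le> s" "s < T"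
    and rc: "\<And>t. 0 \<le> t \<Longrightarrow> eventually (\<lambda>s. X s \<omega> = X t \<omega>) (at_right t)"
  shows "0 < local_time X T \<omega> (X s \<omega>)"
proof -
  obtain b where b: "s < b" "\<And>r. s < r \<Longrightarrow> r < b \<Longrightarrow> X r \<omega> = X s \<omega>"
    using rc[OF s(1)] unfolding eventually_at_right_field by auto
  define b' where "b' = min b T"
  have b': "s < b'" "b' \<le> b" "b' \<le> T" using b s by (auto simp: b'_def)
  have T: "0 < T" using s by simp
  have "b' - s = (LINT r|lborel. indicator {s<..<b'} r)"
    using b' by simp
  also have "\<dots> \<le> local_time X T \<omega> (X s \<omega>)"
    unfolding local_time_def set_lebesgue_integral_def
  proof (rule integral_mono)
    show "integrable lborel (\<lambda>r. indicator {0..T} r *\<^sub>R (indicator {X s \<omega>} (X r \<omega>) :: real))"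
      using local_time_integrable[of T X \<omega>, OF T rc] unfolding set_integrable_def .
    show "integrable lborel (indicator {s<..<b'} :: real \<Rightarrow> real)"
      using b' by (intro integrable_real_indicator) auto
  qed (use b' b s in \<open>auto simp: indicator_def\<close>)
  finally show ?thesis using b' by simp
qed

section \<open>A Feynman--Kac bound for Markov chains in a finite set\<close>

text \<open>
  The left-hand side is the \<open>n\<close>-th power of the kernel \<open>q\<close> applied to \<open>u\<close> at \<open>x0\<close>, written as a sum
  over paths because finite-dimensional distributions come in this form.
\<close>

lemma path_sum_le:
  fixes q :: "'s \<Rightarrow> 's \<Rightarrow> real" and u :: "'s \<Rightarrow> real"
  assumes fin: "finite S" and x0: "x0 \<in> S"
    and q: "\<And>x y. x \<in> S \<Longrightarrow> y \<in> S \<Longrightarrow> 0 \<le> q x y"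
    and l: "0 \<le> l"
    and super: "\<And>x. x \<in> S \<Longrightarrow> (\<Sum>y\<in>S. q x y * u y) \<le> l * u x"
  shows "(\<Sum>x \<in> {..n} \<rightarrow>\<^sub>E S. of_bool (x 0 = x0) * (\<Prod>i<n. q (x i) (x (Suc i))) * u (x n)) \<le> l ^ n * u x0"
proof (induction n)
  case 0
  have "{..0::nat} \<rightarrow>\<^sub>E S = (\<lambda>y. (\<lambda>_. undefined)(0 := y)) ` S"
    using PiE_insert_eq[of "0::nat" "{}" "\<lambda>_. S"] by (force simp: image_def)
  moreover have "inj_on (\<lambda>y. (\<lambda>_. undefined)(0::nat := y)) S"
    by (auto simp: inj_on_def fun_eq_iff)
  ultimately have "(\<Sum>x \<in> {..0} \<rightarrow>\<^sub>E S. of_bool (x 0 = x0) * (\<Prod>i<0. q (x i) (x (Suc i))) * u (x 0))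
      = (\<Sum>y\<in>S. if y = x0 then u y else 0)"
    by (simp add: sum.reindex del: sum_of_bool_mult_eq sum_mult_of_bool_eq) (rule sum.cong, auto)
  then show ?case
    using fin x0 by simp
next
  case (Suc n)
  let ?P = "{..n} \<rightarrow>\<^sub>E S"
  let ?w = "\<lambda>x. of_bool (x 0 = x0) * (\<Prod>i<n. q (x i) (x (Suc i)))"
  have "{..Suc n} \<rightarrow>\<^sub>E S = (\<lambda>(y, x). x(Suc n := y)) ` (S \<times> ?P)"
    using PiE_insert_eq[of "Suc n" "{..n}" "\<lambda>_. S"] by (simp add: atMost_Suc)
  moreover have "inj_on (\<lambda>(y, x). x(Suc n := y)) (S \<times> ?P)"
    using inj_combinator[of "Suc n" "{..n}" "\<lambda>_. S"] by simp
  ultimately have "(\<Sum>x \<in> {..Suc n} \<rightarrow>\<^sub>E S. of_bool (x 0 = x0) * (\<Prod>i<Suc n. q (x i) (x (Suc i))) * u (x (Suc n)))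
      = (\<Sum>(y, x) \<in> S \<times> ?P. ?w x * (q (x n) y * u y))"
    by (simp add: sum.reindex case_prod_unfold mult_ac)
  also have "\<dots> = (\<Sum>x\<in>?P. ?w x * (\<Sum>y\<in>S. q (x n) y * u y))"
    by (simp add: sum.cartesian_product[symmetric] sum_distrib_left, rule sum.swap)
  also have "\<dots> \<le> (\<Sum>x\<in>?P. ?w x * (l * u (x n)))"
    by (intro sum_mono mult_left_mono super mult_nonneg_nonneg prod_nonneg q) (auto simp: PiE_iff)
  also have "\<dots> = l * (\<Sum>x\<in>?P. ?w x * u (x n))"
    by (simp add: sum_distrib_left mult_ac)
  also have "\<dots> \<le> l * (l ^ n * u x0)"
    by (intro mult_left_mono Suc.IH l)
  finally show ?case by (simp add: mult_ac)
qed

text \<open>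
  Formally, \<open>V\<close> is chosen so that \<open>A u + V u = 0\<close> on \<open>S\<close>, with \<open>A\<close> restricted to \<open>S\<close>. Then
  \<open>u (X t) * exp (\<integral>\<^sub>0\<^sup>t V (X s) ds)\<close> is a martingale until the exit from \<open>S\<close>, and it
  dominates \<open>m\<close> times the exponential.

  The expectation is read off from finite-dimensional distributions: on a grid of mesh \<open>h\<close> it is given
  by a power of the finite matrix \<open>p h x y * exp (h * V y)\<close>, which maps \<open>u\<close> to \<open>u\<close> plus an error
  \<open>o(h)\<close>, uniformly because \<open>S\<close> is finite. The variable \<open>\<Psi>\<close> is the lower limit of the grid
  functionals and is bounded by Fatou's lemma. On the event of staying in \<open>S\<close> the grid functionals
  converge to the exponential; stating the bound through \<open>\<Psi>\<close> reduces measurability in \<open>\<omega>\<close> to that of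
  the grid functionals.
\<close>

lemma feynman_kac_bound:
  fixes M :: "'w measure" and A :: "'s \<Rightarrow> 's \<Rightarrow> real"
  assumes mc: "markov_chain M A x0 X"
    and T: "0 < T" and fin: "finite S" and x0: "x0 \<in> S"
    and m: "0 < m" and u: "\<And>x. x \<in> S \<Longrightarrow> m \<le> u x"
    and V: "\<And>x. x \<in> S \<Longrightarrow> V x = - (\<Sum>y\<in>S. A x y * u y) / u x"
  shows "\<exists>\<Psi> \<in> borel_measurable M. (\<integral>\<^sup>+\<omega>. \<Psi> \<omega> \<partial>M) \<le> ennreal (u x0 / m) \<and>
    (\<forall>\<omega>\<in>space M. (\<forall>s. 0 \<le> s \<and> s < T \<longrightarrow> X s \<omega> \<in> S) \<longrightarrow>
       \<Psi> \<omega> = ennreal (exp (\<Sum>x\<in>S. V x * local_time X T \<omega> x)))"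
proof -
  from mc obtain p where
    ps: "prob_space M"
    and meas: "\<And>t. 0 \<le> t \<Longrightarrow> X t \<in> M \<rightarrow>\<^sub>M count_space UNIV"
    and rc: "\<And>\<omega> t. \<omega> \<in> space M \<Longrightarrow> 0 \<le> t \<Longrightarrow> eventually (\<lambda>s. X s \<omega> = X t \<omega>) (at_right t)"
    and tf: "transition_function p" and gen: "has_generator p A"
    and fdd: "\<And>n t x. t 0 = 0 \<Longrightarrow> (\<And>i. i < n \<Longrightarrow> t i \<le> t (Suc i)) \<Longrightarrow>
          measure M {\<omega> \<in> space M. \<forall>i\<le>n. X (t i) \<omega> = x i} =
          of_bool (x 0 = x0) * (\<Prod>i<n. p (t (Suc i) - t i) (x i) (x (Suc i)))"
    unfolding markov_chain_def by blast
  interpret prob_space M by (rule ps)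
  have u_pos: "0 < u x" if "x \<in> S" for x using u[OF that] m by linarith
  have p_nonneg: "0 \<le> t \<Longrightarrow> 0 \<le> p t x y" and p0: "p 0 x y = of_bool (x = y)" for t x y
    using tf unfolding transition_function_def by auto
  define h where "h n = T / real (Suc n)" for n
  have h: "0 < h n" "real n * h n \<le> T" for n
    using T by (auto simp: h_def field_simps)
  define q where "q t x y = p t x y * exp (t * V y)" for t x y
  define E where "E n x = {\<omega> \<in> space M. \<forall>i\<le>n. X (real i * h n) \<omega> = x i}" for n x
  define w where "w n x = (\<Prod>i<n. exp (h n * V (x (Suc i))))" for n and x :: "nat \<Rightarrow> 's"
  define \<Phi> where "\<Phi> n \<omega> = (\<Sum>x\<in>{..n} \<rightarrow>\<^sub>E S. ennreal (w n x) * indicator (E n x) \<omega>)" for n \<omega>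
  have w_nonneg: "0 \<le> w n x" for n x unfolding w_def by (intro prod_nonneg) simp
  have E_meas [measurable]: "E n x \<in> sets M" for n x
  proof -
    have "{\<omega> \<in> space M. X (real i * h n) \<omega> = x i} \<in> sets M" for i
    proof -
      have "X (real i * h n) -` {x i} \<inter> space M \<in> sets M"
        by (rule measurable_sets[OF meas]) (use h(1)[of n] in auto)
      also have "X (real i * h n) -` {x i} \<inter> space M = {\<omega> \<in> space M. X (real i * h n) \<omega> = x i}"
        by auto
      finally show ?thesis .
    qed
    then show ?thesis unfolding E_def
      using sets.sets_Collect_countable_All[of M "\<lambda>i \<omega>. i \<le> n \<longrightarrow> X (real i * h n) \<omega> = x i"]
      by (auto intro!: sets.sets_Collect)
  qed
  have \<Phi>_meas [measurable]: "\<Phi> n \<in> borel_measurable M" for n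
    unfolding \<Phi>_def by measurable

  have E_prob: "measure M (E n x) = of_bool (x 0 = x0) * (\<Prod>i<n. p (h n) (x i) (x (Suc i)))" for n x
    unfolding E_def using h(1)[of n]
    by (subst fdd) (auto simp: algebra_simps)
  have int_\<Phi>: "(\<integral>\<^sup>+\<omega>. \<Phi> n \<omega> \<partial>M) =
      ennreal (\<Sum>x\<in>{..n} \<rightarrow>\<^sub>E S. of_bool (x 0 = x0) * (\<Prod>i<n. q (h n) (x i) (x (Suc i))))" for n
  proof -
    have "(\<integral>\<^sup>+\<omega>. \<Phi> n \<omega> \<partial>M) = (\<Sum>x\<in>{..n} \<rightarrow>\<^sub>E S. ennreal (w n x) * emeasure M (E n x))"
      unfolding \<Phi>_def by (subst nn_integral_sum) (auto simp: nn_integral_cmult_indicator)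
    also have "\<dots> = (\<Sum>x\<in>{..n} \<rightarrow>\<^sub>E S. ennreal (of_bool (x 0 = x0) * (\<Prod>i<n. q (h n) (x i) (x (Suc i)))))"
    proof (rule sum.cong)
      fix x
      have "ennreal (w n x) * emeasure M (E n x) = ennreal (w n x * measure M (E n x))"
        by (simp add: emeasure_eq_measure ennreal_mult w_nonneg)
      also have "w n x * measure M (E n x) = of_bool (x 0 = x0) * (\<Prod>i<n. q (h n) (x i) (x (Suc i)))"
        unfolding E_prob w_def q_def prod.distrib by simp
      finally show "ennreal (w n x) * emeasure M (E n x)
          = ennreal (of_bool (x 0 = x0) * (\<Prod>i<n. q (h n) (x i) (x (Suc i))))" .
    qed simp
    also have "\<dots> = ennreal (\<Sum>x\<in>{..n} \<rightarrow>\<^sub>E S. of_bool (x 0 = x0) * (\<Prod>i<n. q (h n) (x i) (x (Suc i))))"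
      by (intro sum_ennreal mult_nonneg_nonneg prod_nonneg)
         (use h(1)[of n] in \<open>auto simp: q_def intro!: mult_nonneg_nonneg p_nonneg\<close>)
    finally show ?thesis .
  qed

  \<comment> \<open>the derivative at \<open>0\<close> is \<open>A u + V u\<close>, which vanishes by the choice of \<open>V\<close>\<close>
  have deriv: "((\<lambda>t. \<Sum>y\<in>S. q t x y * u y) has_real_derivative 0) (at 0 within {0..})"
    if x: "x \<in> S" for x
  proof -
    have "((\<lambda>t. q t x y) has_real_derivative
        A x y * exp (0 * V y) + (exp (0 * V y) * (1 * V y)) * p 0 x y) (at 0 within {0..})" for y
      unfolding q_def
      by (intro DERIV_mult) (use gen in \<open>auto simp: has_generator_def intro!: derivative_eq_intros\<close>)
    then have "((\<lambda>t. \<Sum>y\<in>S. q t x y * u y) has_real_derivative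
        (\<Sum>y\<in>S. (A x y + V y * of_bool (x = y)) * u y)) (at 0 within {0..})"
      by (intro DERIV_sum DERIV_cmult_right) (simp add: p0)
    also have "(\<Sum>y\<in>S. (A x y + V y * of_bool (x = y)) * u y) = (\<Sum>y\<in>S. A x y * u y) + V x * u x"
    proof -
      have "(\<Sum>y\<in>S. (A x y + V y * of_bool (x = y)) * u y)
          = (\<Sum>y\<in>S. A x y * u y) + (\<Sum>y\<in>S. if x = y then V y * u y else 0)"
        by (subst sum.distrib[symmetric]) (intro sum.cong, auto simp: algebra_simps)
      then show ?thesis using fin x by simp
    qed
    also have "\<dots> = 0"
      using u_pos[OF x] V[OF x] by simp
    finally show ?thesis .
  qed
  have one_step: "eventually (\<lambda>t. \<forall>x\<in>S. (\<Sum>y\<in>S. q t x y * u y) \<le> (1 + \<eta> * t) * u x) (at_right 0)"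
    if \<eta>: "0 < \<eta>" for \<eta>
  proof (rule eventually_ball_finite[OF fin], rule ballI)
    fix x assume x: "x \<in> S"
    have "(\<Sum>y\<in>S. q 0 x y * u y) = (\<Sum>y\<in>S. if x = y then u y else 0)"
      by (intro sum.cong) (auto simp: q_def p0)
    also have "\<dots> = u x" using fin x by simp
    finally have q0: "(\<Sum>y\<in>S. q 0 x y * u y) = u x" .
    have "((\<lambda>t. ((\<Sum>y\<in>S. q t x y * u y) - u x) / t) \<longlongrightarrow> 0) (at 0 within {0..})"
      using deriv[OF x] unfolding has_field_derivative_iff q0 by simp
    moreover have "at 0 within {0..} = at_right (0::real)"
      by (rule at_within_Ici_at_right)
    ultimately have "eventually (\<lambda>t. ((\<Sum>y\<in>S. q t x y * u y) - u x) / t < \<eta> * u x) (at_right 0)"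
      using \<eta> u_pos[OF x] by (intro order_tendstoD(2)[of _ 0]) auto
    moreover have "eventually (\<lambda>t::real. 0 < t) (at_right 0)"
      by (rule eventually_at_right_less)
    ultimately show "eventually (\<lambda>t. (\<Sum>y\<in>S. q t x y * u y) \<le> (1 + \<eta> * t) * u x) (at_right 0)"
      by eventually_elim (simp add: pos_divide_less_eq algebra_simps)
  qed
  have h_right: "filterlim h (at_right 0) sequentially"
  proof -
    have "h \<longlonglongrightarrow> 0" unfolding h_def by (rule LIMSEQ_Suc, rule lim_const_over_n)
    moreover have "h n \<noteq> 0" for n using h(1)[of n] by simp
    ultimately show ?thesis
      unfolding filterlim_at using h(1) by (simp add: always_eventually)
  qed

  have liminf_le: "(\<integral>\<^sup>+\<omega>. liminf (\<lambda>n. \<Phi> n \<omega>) \<partial>M) \<le> ennreal (exp (\<eta> * T) * (u x0 / m))"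
    if \<eta>: "0 < \<eta>" for \<eta>
  proof -
    have "eventually (\<lambda>n. (\<integral>\<^sup>+\<omega>. \<Phi> n \<omega> \<partial>M) \<le> ennreal (exp (\<eta> * T) * (u x0 / m))) sequentially"
      using eventually_compose_filterlim[OF one_step[OF \<eta>] h_right]
    proof eventually_elim
      case (elim n)
      let ?W = "\<lambda>x. of_bool (x 0 = x0) * (\<Prod>i<n. q (h n) (x i) (x (Suc i)))"
      have q_nonneg: "0 \<le> q (h n) x y" for x y
        unfolding q_def using h(1)[of n] by (intro mult_nonneg_nonneg p_nonneg) auto
      have "m * (\<Sum>x\<in>{..n} \<rightarrow>\<^sub>E S. ?W x) \<le> (\<Sum>x\<in>{..n} \<rightarrow>\<^sub>E S. ?W x * u (x n))"
        unfolding sum_distrib_left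
      proof (rule sum_mono)
        fix x assume "x \<in> {..n} \<rightarrow>\<^sub>E S"
        then have "m \<le> u (x n)" by (intro u) auto
        then have "?W x * m \<le> ?W x * u (x n)"
          by (intro mult_left_mono mult_nonneg_nonneg prod_nonneg) (auto intro: q_nonneg)
        then show "m * ?W x \<le> ?W x * u (x n)" by (simp add: mult.commute)
      qed
      also have "\<dots> \<le> (1 + \<eta> * h n) ^ n * u x0"
        by (rule path_sum_le) (use fin x0 q_nonneg \<eta> h(1)[of n] elim in auto)
      also have "\<dots> \<le> exp (\<eta> * h n) ^ n * u x0"
        using u_pos[OF x0] \<eta> h(1)[of n] by (intro mult_right_mono power_mono) auto
      also have "exp (\<eta> * h n) ^ n = exp (\<eta> * (real n * h n))"
        by (simp add: exp_of_nat_mult[symmetric] mult_ac)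
      also have "\<dots> * u x0 \<le> exp (\<eta> * T) * u x0"
        using u_pos[OF x0] \<eta> h(2)[of n] by (intro mult_right_mono) auto
      finally have "(\<Sum>x\<in>{..n} \<rightarrow>\<^sub>E S. ?W x) \<le> exp (\<eta> * T) * (u x0 / m)"
        using m by (simp add: field_simps)
      then show ?case unfolding int_\<Phi> by (rule ennreal_leI)
    qed
    then have "liminf (\<lambda>n. \<integral>\<^sup>+\<omega>. \<Phi> n \<omega> \<partial>M) \<le> ennreal (exp (\<eta> * T) * (u x0 / m))"
      by (rule Liminf_le[OF sequentially_bot])
    then show ?thesis
      using nn_integral_liminf[of \<Phi> M] \<Phi>_meas by (metis (no_types, lifting) order_trans)
  qed
  have "((\<lambda>\<eta>. ennreal (exp (\<eta> * T) * (u x0 / m))) \<longlongrightarrow> ennreal (exp (0 * T) * (u x0 / m))) (at_right 0)"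
    by (intro tendsto_ennrealI tendsto_intros)
  then have "((\<lambda>\<eta>. ennreal (exp (\<eta> * T) * (u x0 / m))) \<longlongrightarrow> ennreal (u x0 / m)) (at_right 0)"
    by simp
  moreover have "eventually (\<lambda>\<eta>. (\<integral>\<^sup>+\<omega>. liminf (\<lambda>n. \<Phi> n \<omega>) \<partial>M)
      \<le> ennreal (exp (\<eta> * T) * (u x0 / m))) (at_right 0)"
    using eventually_at_right_less[of "0::real"] by eventually_elim (rule liminf_le)
  ultimately have bound: "(\<integral>\<^sup>+\<omega>. liminf (\<lambda>n. \<Phi> n \<omega>) \<partial>M) \<le> ennreal (u x0 / m)"
    by (rule tendsto_lowerbound) (rule trivial_limit_at_right_real)

  have path: "liminf (\<lambda>n. \<Phi> n \<omega>) = ennreal (exp (\<Sum>x\<in>S. V x * local_time X T \<omega> x))"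
    if \<omega>: "\<omega> \<in> space M" and stay: "\<And>s. 0 \<le> s \<Longrightarrow> s < T \<Longrightarrow> X s \<omega> \<in> S" for \<omega>
  proof -
    have grid: "X (real i * h n) \<omega> \<in> S" if "i \<le> n" for i n
    proof -
      have "real i * h n < real (Suc n) * h n" using that h(1)[of n] by (intro mult_strict_right_mono) auto
      also have "\<dots> = T" by (simp add: h_def)
      finally have "real i * h n < T" .
      then show ?thesis using h(1)[of n] by (intro stay) auto
    qed
    have \<Phi>_eq: "\<Phi> n \<omega> = ennreal (exp (\<Sum>i<n. h n * V (X (real (Suc i) * h n) \<omega>)))" for n
    proof -
      \<comment> \<open>only the path that \<open>\<omega>\<close> follows on the grid contributes to \<open>\<Phi>\<close>\<close>
      define z where "z = restrict (\<lambda>i. X (real i * h n) \<omega>) {..n}"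
      have z: "z \<in> {..n} \<rightarrow>\<^sub>E S" using grid by (auto simp: z_def)
      have "\<omega> \<in> E n x \<longleftrightarrow> x = z" if "x \<in> {..n} \<rightarrow>\<^sub>E S" for x
      proof
        assume "\<omega> \<in> E n x"
        then show "x = z" by (intro PiE_ext[OF that z]) (auto simp: E_def z_def)
      qed (use \<omega> in \<open>auto simp: E_def z_def\<close>)
      then have "\<Phi> n \<omega> = (\<Sum>x\<in>{..n} \<rightarrow>\<^sub>E S. if x = z then ennreal (w n x) else 0)"
        unfolding \<Phi>_def by (intro sum.cong) (auto simp: indicator_def)
      also have "\<dots> = ennreal (w n z)"
        using z fin by (simp add: finite_PiE)
      also have "w n z = exp (\<Sum>i<n. h n * V (X (real (Suc i) * h n) \<omega>))"
        unfolding w_def z_def exp_sum[OF finite_lessThan] by (intro prod.cong) auto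
      finally show ?thesis .
    qed
    have "(\<Sum>i<n. h n * V (X (real (Suc i) * h n) \<omega>))
        = (\<Sum>x\<in>S. V x * (\<Sum>i<n. h n * indicator {x} (X (real (Suc i) * h n) \<omega>)))" for n
    proof -
      have "h n * V (X (real (Suc i) * h n) \<omega>)
         = (\<Sum>x\<in>S. V x * (h n * indicator {x} (X (real (Suc i) * h n) \<omega>)))" if "i < n" for i
      proof -
        have "V x * (h n * indicator {x} (X (real (Suc i) * h n) \<omega>)) =
            V (X (real (Suc i) * h n) \<omega>) * h n * indicator {x} (X (real (Suc i) * h n) \<omega>)" for x
          by (auto simp: indicator_def)
        then have "(\<Sum>x\<in>S. V x * (h n * indicator {x} (X (real (Suc i) * h n) \<omega>))) =
            (\<Sum>x\<in>S. V (X (real (Suc i) * h n) \<omega>) * h n * indicator {x} (X (real (Suc i) * h n) \<omega>))"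
          by (intro sum.cong refl)
        also have "\<dots> = V (X (real (Suc i) * h n) \<omega>) * h n"
          by (rule sum_mult_indicator_singleton[OF fin grid]) (use that in simp)
        finally show ?thesis by simp
      qed
      then have "(\<Sum>i<n. h n * V (X (real (Suc i) * h n) \<omega>))
          = (\<Sum>i<n. \<Sum>x\<in>S. V x * (h n * indicator {x} (X (real (Suc i) * h n) \<omega>)))"
        by simp
      also have "\<dots> = (\<Sum>x\<in>S. \<Sum>i<n. V x * (h n * indicator {x} (X (real (Suc i) * h n) \<omega>)))"
        by (rule sum.swap)
      finally show ?thesis unfolding sum_distrib_left .
    qed
    moreover have "(\<lambda>n. \<Sum>x\<in>S. V x * (\<Sum>i<n. h n * indicator {x} (X (real (Suc i) * h n) \<omega>)))
        \<longlonglongrightarrow> (\<Sum>x\<in>S. V x * local_time X T \<omega> x)"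
      unfolding h_def
      by (intro tendsto_sum tendsto_mult tendsto_const local_time_riemann_sum[of T X \<omega>, OF T rc[OF \<omega>]])
    ultimately have "(\<lambda>n. \<Sum>i<n. h n * V (X (real (Suc i) * h n) \<omega>))
        \<longlonglongrightarrow> (\<Sum>x\<in>S. V x * local_time X T \<omega> x)"
      by (simp only:)
    then have "(\<lambda>n. \<Phi> n \<omega>) \<longlonglongrightarrow> ennreal (exp (\<Sum>x\<in>S. V x * local_time X T \<omega> x))"
      unfolding \<Phi>_eq by (intro tendsto_ennrealI tendsto_exp)
    then show ?thesis by (intro lim_imp_Liminf) simp
  qed
  show ?thesis
    by (rule bexI[of _ "\<lambda>\<omega>. liminf (\<lambda>n. \<Phi> n \<omega>)"]) (use bound path in auto)
qed

section \<open>The lattice Dirichlet form\<close>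

lemma neighbours_sym: "neighbours x y \<longleftrightarrow> neighbours y x"
proof -
  have "(\<chi> i. real_of_int (x $ i - y $ i)) = - (\<chi> i. real_of_int (y $ i - x $ i))"
    by (simp add: vec_eq_iff)
  then show ?thesis unfolding neighbours_def by (simp only: norm_minus_cancel)
qed

lemma not_neighbours_self: "\<not> neighbours x x"
proof -
  have "(\<chi> i. real_of_int (x $ i - x $ i)) = 0" by (simp add: vec_eq_iff)
  then show ?thesis unfolding neighbours_def by simp
qed

text \<open>
  The squares of the coordinates of \<open>y - x\<close> are nonnegative integers with sum \<open>1\<close>, so exactly one of
  them is not \<open>0\<close>.
\<close>

lemma neighbours_subset:
  fixes x :: "int ^ 'd"
  shows "{y. neighbours x y} \<subseteq> (\<lambda>(i, s). x + axis i s) ` (UNIV \<times> {1, -1})"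
proof
  fix y assume "y \<in> {y. neighbours x y}"
  then have "norm (\<chi> i. real_of_int (x $ i - y $ i)) = 1" by (simp add: neighbours_def)
  then have "(\<Sum>i\<in>UNIV. (real_of_int (x $ i - y $ i))\<^sup>2) = 1"
    by (simp add: norm_vec_def L2_set_def)
  also have "(\<Sum>i\<in>UNIV. (real_of_int (x $ i - y $ i))\<^sup>2) = real_of_int (\<Sum>i\<in>UNIV. (y $ i - x $ i)\<^sup>2)"
    by (simp only: of_int_sum of_int_power power2_commute[of "real_of_int (_ - _)"] of_int_diff power2_commute)
  finally have sum1: "(\<Sum>i\<in>UNIV. (y $ i - x $ i)\<^sup>2) = 1" by (simp only: of_int_eq_1_iff)
  then obtain i where i: "y $ i - x $ i \<noteq> 0" by (metis (no_types, lifting) power_zero_numeral sum.neutral zero_neq_one)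
  have "(y $ i - x $ i)\<^sup>2 + (\<Sum>j\<in>UNIV - {i}. (y $ j - x $ j)\<^sup>2) = 1"
    using sum1 by (simp add: sum.remove[of UNIV i])
  moreover have "1 \<le> (y $ i - x $ i)\<^sup>2" using i by (simp add: int_one_le_iff_zero_less)
  moreover have "0 \<le> (\<Sum>j\<in>UNIV - {i}. (y $ j - x $ j)\<^sup>2)" by (simp add: sum_nonneg)
  ultimately have 1: "(y $ i - x $ i)\<^sup>2 = 1" and "(\<Sum>j\<in>UNIV - {i}. (y $ j - x $ j)\<^sup>2) = 0"
    by linarith+
  then have 0: "y $ j = x $ j" if "j \<noteq> i" for j
    using that by (subst (asm) sum_nonneg_eq_0_iff) auto
  have "y = x + axis i (y $ i - x $ i)"
    using 0 by (auto simp: vec_eq_iff axis_def)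
  moreover have "y $ i - x $ i \<in> {1, -1}" using 1 by (auto simp: power2_eq_1_iff)
  ultimately show "y \<in> (\<lambda>(i, s). x + axis i s) ` (UNIV \<times> {1, -1})"
    by (intro image_eqI[of _ _ "(i, y $ i - x $ i)"]) auto
qed

lemma finite_neighbours: "finite {y. neighbours x y}"
  by (rule finite_subset[OF neighbours_subset]) auto

lemma card_neighbours_le: "card {y. neighbours (x :: int ^ 'd) y} \<le> 2 * CARD('d)"
proof -
  have "card {y. neighbours x y} \<le> card ((\<lambda>(i, s). x + axis i s) ` ((UNIV :: 'd set) \<times> {1, -1}))"
    by (rule card_mono[OF _ neighbours_subset]) auto
  also have "\<dots> \<le> card ((UNIV :: 'd set) \<times> {1, -1::int})"
    by (rule card_image_le) auto
  finally show ?thesis by (simp add: card_cartesian_product)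
qed

text \<open>
  The quadratic form of minus the Laplacian with zero boundary condition outside \<open>S\<close>, evaluated at
  \<open>sqrt f\<close>. It is the rate function of the local times.
\<close>

definition dirichlet_form :: "(int ^ 'd) set \<Rightarrow> (int ^ 'd \<Rightarrow> real) \<Rightarrow> real" where
  "dirichlet_form S f = - (\<Sum>x\<in>S. \<Sum>y\<in>S. lattice_laplacian x y * sqrt (f x) * sqrt (f y))"

text \<open>
  Expanding the squares gives the off-diagonal part of the form from the mixed terms, and the
  diagonal part from the number of neighbours of a site, which is bounded by \<open>2 * CARD('d)\<close>.
\<close>

lemma discrete_energy_le_dirichlet_form:
  fixes \<mu> :: "(int ^ 'd) pmf"
  assumes fin: "finite S" and supp: "set_pmf \<mu> \<subseteq> S"
  shows "discrete_energy \<mu> \<le> dirichlet_form S (pmf \<mu>)"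
proof -
  define r where "r x = sqrt (pmf \<mu> x)" for x
  have r2: "(r x)\<^sup>2 = pmf \<mu> x" for x by (simp add: r_def)
  have r0: "r x = 0" if "x \<notin> S" for x
    using that supp by (auto simp: r_def set_pmf_iff)
  define N where "N = {(x, y). neighbours (x :: int ^ 'd) y}"
  define B where "B = (SIGMA x:S. {y. neighbours x y})"
  \<comment> \<open>the finitely many neighbour pairs on which \<open>r x - r y\<close> may be nonzero\<close>
  define P where "P = B \<union> prod.swap ` B"
  have finB: "finite B" unfolding B_def using fin finite_neighbours by auto
  then have finP: "finite P" by (simp add: P_def)
  have PN: "P \<subseteq> N"
    unfolding P_def B_def N_def using neighbours_sym by (auto dest: iffD1[OF neighbours_sym])
  then have P_nb: "neighbours x y" if "(x, y) \<in> P" for x y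
    using that by (auto simp: N_def)
  then have B_left: "fst z \<notin> S" if "z \<in> P - B" for z
    using that by (cases z) (auto simp: B_def)
  have out: "x \<notin> S \<and> y \<notin> S" if "(x, y) \<in> N - P" for x y
    using that by (force simp: P_def B_def N_def neighbours_sym)
  have "(\<Sum>\<^sub>\<infinity>(x, y)\<in>N. (r x - r y)\<^sup>2) = (\<Sum>\<^sub>\<infinity>(x, y)\<in>P. (r x - r y)\<^sup>2)"
    using PN out r0 by (intro infsum_cong_neutral) auto
  also have "\<dots> = (\<Sum>(x, y)\<in>P. (r x - r y)\<^sup>2)"
    using finP by simp
  also have "\<dots> = (\<Sum>z\<in>P. pmf \<mu> (fst z)) + (\<Sum>z\<in>P. pmf \<mu> (snd z)) - 2 * (\<Sum>z\<in>P. r (fst z) * r (snd z))"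
    by (simp add: case_prod_unfold power2_diff r2 sum.distrib sum_subtractf sum_distrib_left mult.assoc)
  also have "(\<Sum>z\<in>P. pmf \<mu> (snd z)) = (\<Sum>z\<in>P. pmf \<mu> (fst z))"
    by (rule sum.reindex_bij_witness[of _ prod.swap prod.swap]) (auto simp: P_def image_iff)
  also have "(\<Sum>z\<in>P. pmf \<mu> (fst z)) = (\<Sum>z\<in>B. pmf \<mu> (fst z))"
  proof (rule sum.mono_neutral_right[OF finP])
    show "\<forall>z\<in>P - B. pmf \<mu> (fst z) = 0"
      using r0 B_left unfolding r_def by auto
  qed (simp add: P_def)
  also have "(\<Sum>z\<in>P. r (fst z) * r (snd z)) = (\<Sum>z\<in>B. r (fst z) * r (snd z))"
  proof (rule sum.mono_neutral_right[OF finP])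
    show "\<forall>z\<in>P - B. r (fst z) * r (snd z) = 0"
      using r0 B_left by auto
  qed (simp add: P_def)
  also have "(\<Sum>z\<in>B. r (fst z) * r (snd z)) = (\<Sum>x\<in>S. \<Sum>y\<in>{y. neighbours x y}. r x * r y)"
    unfolding B_def using fin finite_neighbours by (subst sum.Sigma) (auto simp: case_prod_unfold)
  also have "(\<Sum>z\<in>B. pmf \<mu> (fst z)) = (\<Sum>x\<in>S. \<Sum>y\<in>{y. neighbours x y}. pmf \<mu> x)"
    unfolding B_def using fin finite_neighbours by (subst sum.Sigma) (auto simp: case_prod_unfold)
  also have "(\<Sum>x\<in>S. \<Sum>y\<in>{y. neighbours x y}. pmf \<mu> x) \<le> (\<Sum>x\<in>S. 2 * real CARD('d) * pmf \<mu> x)"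
  proof (rule sum_mono)
    fix x :: "int ^ 'd"
    have "real (card {y. neighbours x y}) \<le> 2 * real CARD('d)"
      using card_neighbours_le[of x] by linarith
    then show "(\<Sum>y\<in>{y. neighbours x y}. pmf \<mu> x) \<le> 2 * real CARD('d) * pmf \<mu> x"
      by (simp add: mult_right_mono)
  qed
  finally have "discrete_energy \<mu> \<le> (\<Sum>x\<in>S. 2 * real CARD('d) * pmf \<mu> x)
      - (\<Sum>x\<in>S. \<Sum>y\<in>{y. neighbours x y}. r x * r y)"
    unfolding discrete_energy_def r_def N_def by simp
  also have "\<dots> = dirichlet_form S (pmf \<mu>)"
  proof -
    have "2 * real CARD('d) * pmf \<mu> x - (\<Sum>y\<in>{y. neighbours x y}. r x * r y)
        = - (\<Sum>y\<in>S. lattice_laplacian x y * sqrt (pmf \<mu> x) * sqrt (pmf \<mu> y))" if x: "x \<in> S" for x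
    proof -
      have "(\<Sum>y\<in>{y. neighbours x y}. r x * r y) = (\<Sum>y\<in>{y\<in>S. neighbours x y}. r x * r y)"
        by (rule sum.mono_neutral_right) (use finite_neighbours r0 in auto)
      also have "\<dots> = (\<Sum>y\<in>S. if neighbours x y then r x * r y else 0)"
        by (rule sum.inter_filter[OF fin])
      finally have nb: "(\<Sum>y\<in>{y. neighbours x y}. r x * r y) = (\<Sum>y\<in>S. if neighbours x y then r x * r y else 0)" .
      have "(\<Sum>y\<in>S. lattice_laplacian x y * sqrt (pmf \<mu> x) * sqrt (pmf \<mu> y))
         = (\<Sum>y\<in>S. (if neighbours x y then r x * r y else 0) + (if x = y then - 2 * real CARD('d) * pmf \<mu> y else 0))"
        by (intro sum.cong) (auto simp: lattice_laplacian_def not_neighbours_self r_def)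
      also have "\<dots> = (\<Sum>y\<in>S. if neighbours x y then r x * r y else 0) - 2 * real CARD('d) * pmf \<mu> x"
        using fin x by (simp add: sum.distrib)
      finally show ?thesis using nb by simp
    qed
    then show ?thesis
      unfolding dirichlet_form_def sum_subtractf[symmetric] sum_negf[symmetric]
      by (intro sum.cong) auto
  qed
  finally show ?thesis .
qed

text \<open>
  If \<open>u = sqrt f\<close> is positive, both sides agree apart from the error term, since
  \<open>f x / u x = sqrt (f x)\<close>. The diagonal terms agree for every \<open>u\<close>. Off the diagonal, choosing \<open>u\<close> slightly larger than \<open>sqrt f\<close>
  keeps \<open>f x / u x \<le> sqrt (f x)\<close> and costs at most \<open>sqrt \<epsilon>\<close> in the factor \<open>u y\<close>. So one \<open>u\<close>, bounded
  away from \<open>0\<close>, serves all \<open>f\<close> in a small cell.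
\<close>

lemma dirichlet_form_le_potential:
  fixes S :: "(int ^ 'd) set"
  assumes fin: "finite S" and e: "0 \<le> \<epsilon>"
    and f: "\<And>x. x \<in> S \<Longrightarrow> 0 \<le> f x" "\<And>x. x \<in> S \<Longrightarrow> f x \<le> 1"
    and u: "\<And>x. x \<in> S \<Longrightarrow> 0 < u x"
      "\<And>x. x \<in> S \<Longrightarrow> f x \<le> (u x)\<^sup>2" "\<And>x. x \<in> S \<Longrightarrow> (u x)\<^sup>2 \<le> f x + \<epsilon>"
  shows "dirichlet_form S f \<le>
    (\<Sum>x\<in>S. (- (\<Sum>y\<in>S. lattice_laplacian x y * u y) / u x) * f x) + 2 * CARD('d) * card S * sqrt \<epsilon>"
proof -
  have pair: "lattice_laplacian x y * (u y / u x * f x) - lattice_laplacian x y * sqrt (f x) * sqrt (f y)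
      \<le> (if neighbours x y then sqrt \<epsilon> else 0)" if x: "x \<in> S" and y: "y \<in> S" for x y
  proof -
    have lo: "sqrt (f x) \<le> u x"
      using u(1,2)[OF x] by (intro real_le_lsqrt) auto
    have "u y = sqrt ((u y)\<^sup>2)" using u(1)[OF y] by simp
    also have "\<dots> \<le> sqrt (f y + \<epsilon>)" using u(3)[OF y] by (rule real_sqrt_le_mono)
    also have "\<dots> \<le> sqrt (f y) + sqrt \<epsilon>"
      using f(1)[OF y] e by (rule sqrt_add_le_add_sqrt)
    finally have hi: "u y \<le> sqrt (f y) + sqrt \<epsilon>" .
    have "u y / u x * f x = (f x / u x) * u y" by simp
    also have "f x / u x \<le> sqrt (f x)"
    proof -
      have "f x = sqrt (f x) * sqrt (f x)" using f(1)[OF x] by simp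
      also have "\<dots> \<le> sqrt (f x) * u x" using lo f(1)[OF x] by (intro mult_left_mono) auto
      finally show ?thesis using u(1)[OF x] by (simp add: pos_divide_le_eq)
    qed
    then have "(f x / u x) * u y \<le> sqrt (f x) * (sqrt (f y) + sqrt \<epsilon>)"
      using hi u(1)[OF y] f(1)[OF x] by (intro mult_mono) auto
    also have "\<dots> \<le> sqrt (f x) * sqrt (f y) + 1 * sqrt \<epsilon>"
      using f[OF x] e by (simp add: distrib_left mult_left_le_one_le)
    finally have main: "u y / u x * f x \<le> sqrt (f x) * sqrt (f y) + sqrt \<epsilon>" by simp
    show ?thesis
      using main not_neighbours_self[of x] f(1)[OF x] u(1)[OF x]
      by (auto simp: lattice_laplacian_def)
  qed
  have "(\<Sum>x\<in>S. \<Sum>y\<in>S. lattice_laplacian x y * (u y / u x * f x) - lattice_laplacian x y * sqrt (f x) * sqrt (f y))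
      \<le> (\<Sum>x\<in>S. \<Sum>y\<in>S. if neighbours x y then sqrt \<epsilon> else 0)"
    by (intro sum_mono pair)
  also have "\<dots> \<le> (\<Sum>x\<in>S. 2 * real CARD('d) * sqrt \<epsilon>)"
  proof (rule sum_mono)
    fix x :: "int ^ 'd"
    have "(\<Sum>y\<in>S. if neighbours x y then sqrt \<epsilon> else 0) = real (card {y\<in>S. neighbours x y}) * sqrt \<epsilon>"
      by (subst sum.inter_filter[OF fin, symmetric]) simp
    also have "\<dots> \<le> 2 * real CARD('d) * sqrt \<epsilon>"
    proof (rule mult_right_mono)
      have "card {y\<in>S. neighbours x y} \<le> card {y. neighbours x y}"
        by (rule card_mono[OF finite_neighbours]) auto
      then show "real (card {y\<in>S. neighbours x y}) \<le> 2 * real CARD('d)"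
        using card_neighbours_le[of x] by linarith
    qed (use e in simp)
    finally show "(\<Sum>y\<in>S. if neighbours x y then sqrt \<epsilon> else 0) \<le> 2 * real CARD('d) * sqrt \<epsilon>" .
  qed
  finally have "(\<Sum>x\<in>S. \<Sum>y\<in>S. lattice_laplacian x y * (u y / u x * f x))
       + dirichlet_form S f \<le> 2 * CARD('d) * card S * sqrt \<epsilon>"
    unfolding dirichlet_form_def by (simp add: sum_subtractf mult_ac)
  moreover have "(\<Sum>x\<in>S. \<Sum>y\<in>S. lattice_laplacian x y * (u y / u x * f x))
      = - (\<Sum>x\<in>S. (- (\<Sum>y\<in>S. lattice_laplacian x y * u y) / u x) * f x)"
    by (simp add: sum_negf sum_distrib_right sum_divide_distrib mult.assoc)
  ultimately show ?thesis by linarith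
qed

section \<open>Exponential moments of the energy of the local times\<close>

text \<open>
  The exponential moment of the rate function itself, at the full speed \<open>T\<close>, is at most
  \<open>exp (O(card S * ln T))\<close> for large \<open>T\<close> when \<open>N\<close> is of order \<open>T\<^sup>2\<close>. The normalised local
  times on \<open>S\<close> lie in the unit cube of dimension \<open>card S\<close>, which is cut into cells of side \<open>1 / N\<close>, labelled by \<open>k\<close>. All profiles in one cell share
  the function \<open>u k\<close>, whose square is the upper corner of the cell; so \<open>u k\<close> is at least
  \<open>1 / sqrt N\<close>, and its square exceeds the profile by at most \<open>1 / N\<close>. The
  Feynman--Kac bound for each \<open>u k\<close> gives the factor \<open>sqrt (2 * N)\<close>, the number of cells gives \<open>(N + 1) ^ card S\<close>, and the last factor pays for
  replacing the form by the potential.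
\<close>

lemma exponential_energy_bound:
  fixes X :: "real \<Rightarrow> 'w \<Rightarrow> int ^ 'd" and T :: real
  assumes walk: "simple_random_walk M X"
    and fin: "finite S" and S0: "0 \<in> S" and T: "0 < T" and N: "1 \<le> (N::nat)"
  shows "\<exists>\<Psi> \<in> borel_measurable M.
    (\<integral>\<^sup>+\<omega>. \<Psi> \<omega> \<partial>M) \<le> ennreal (real (N + 1) ^ card S * sqrt (2 * real N) * exp (2 * CARD('d) * card S * T / sqrt N)) \<and>
    (\<forall>\<omega>\<in>space M. (\<forall>s. 0 \<le> s \<and> s < T \<longrightarrow> X s \<omega> \<in> S) \<longrightarrow>
       ennreal (exp (T * dirichlet_form S (\<lambda>x. local_time X T \<omega> x / T))) \<le> \<Psi> \<omega>)"
proof -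
  define K where "K = S \<rightarrow>\<^sub>E {..N}"
  have finK: "finite K" unfolding K_def by (intro finite_PiE fin) auto
  define u where "u k x = sqrt (real (k x + 1) / N)" for k :: "int ^ 'd \<Rightarrow> nat" and x
  define V where "V k x = - (\<Sum>y\<in>S. lattice_laplacian x y * u k y) / u k x" for k x
  have mc: "markov_chain M lattice_laplacian 0 X"
    using walk by (simp add: simple_random_walk_def)
  have "\<exists>\<Psi> \<in> borel_measurable M. (\<integral>\<^sup>+\<omega>. \<Psi> \<omega> \<partial>M) \<le> ennreal (u k 0 / (1 / sqrt N)) \<and>
    (\<forall>\<omega>\<in>space M. (\<forall>s. 0 \<le> s \<and> s < T \<longrightarrow> X s \<omega> \<in> S) \<longrightarrow>
       \<Psi> \<omega> = ennreal (exp (\<Sum>x\<in>S. V k x * local_time X T \<omega> x)))" for k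
  proof (rule feynman_kac_bound[OF mc T fin S0, where u = "u k" and m = "1 / sqrt N" and V = "V k"])
    show "1 / sqrt N \<le> u k x" for x
      using N by (simp add: u_def real_sqrt_divide divide_right_mono)
  qed (use N in \<open>simp_all add: V_def\<close>)
  then have "\<forall>k. \<exists>\<Psi>. \<Psi> \<in> borel_measurable M \<and>
    (\<integral>\<^sup>+\<omega>. \<Psi> \<omega> \<partial>M) \<le> ennreal (u k 0 / (1 / sqrt N)) \<and>
    (\<forall>\<omega>\<in>space M. (\<forall>s. 0 \<le> s \<and> s < T \<longrightarrow> X s \<omega> \<in> S) \<longrightarrow>
       \<Psi> \<omega> = ennreal (exp (\<Sum>x\<in>S. V k x * local_time X T \<omega> x)))"
    unfolding Bex_def ..
  from choice[OF this] obtain \<Psi> where all: "\<forall>k. \<Psi> k \<in> borel_measurable M \<and>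
    (\<integral>\<^sup>+\<omega>. \<Psi> k \<omega> \<partial>M) \<le> ennreal (u k 0 / (1 / sqrt N)) \<and>
    (\<forall>\<omega>\<in>space M. (\<forall>s. 0 \<le> s \<and> s < T \<longrightarrow> X s \<omega> \<in> S) \<longrightarrow>
       \<Psi> k \<omega> = ennreal (exp (\<Sum>x\<in>S. V k x * local_time X T \<omega> x)))" ..
  then have \<Psi> [measurable]: "\<And>k. \<Psi> k \<in> borel_measurable M"
    and \<Psi>_int: "\<And>k. (\<integral>\<^sup>+\<omega>. \<Psi> k \<omega> \<partial>M) \<le> ennreal (u k 0 / (1 / sqrt N))"
    by blast+
  have \<Psi>_path: "\<Psi> k \<omega> = ennreal (exp (\<Sum>x\<in>S. V k x * local_time X T \<omega> x))"
    if "\<omega> \<in> space M" "\<And>s. 0 \<le> s \<Longrightarrow> s < T \<Longrightarrow> X s \<omega> \<in> S" for k \<omega>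
    using all that by blast
  define c where "c = exp (2 * CARD('d) * card S * T / sqrt N)"
  have c: "0 < c" by (simp add: c_def)
  define \<Theta> where "\<Theta> \<omega> = (\<Sum>k\<in>K. ennreal c * \<Psi> k \<omega>)" for \<omega>
  show ?thesis
  proof (intro bexI[of _ \<Theta>] conjI ballI impI)
    show "\<Theta> \<in> borel_measurable M" unfolding \<Theta>_def by measurable
    have "(\<integral>\<^sup>+\<omega>. \<Theta> \<omega> \<partial>M) = (\<Sum>k\<in>K. ennreal c * (\<integral>\<^sup>+\<omega>. \<Psi> k \<omega> \<partial>M))"
      unfolding \<Theta>_def by (simp add: nn_integral_sum nn_integral_cmult)
    also have "\<dots> \<le> (\<Sum>k\<in>K. ennreal c * ennreal (sqrt (2 * real N)))"
    proof (intro sum_mono mult_left_mono)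
      fix k assume "k \<in> K"
      then have "k 0 \<le> N" using S0 by (auto simp: K_def)
      have "u k 0 / (1 / sqrt N) = sqrt (real (k 0 + 1))"
        using N by (simp add: u_def real_sqrt_divide)
      also have "\<dots> \<le> sqrt (2 * real N)"
        using \<open>k 0 \<le> N\<close> N by (intro real_sqrt_le_mono) simp
      finally show "(\<integral>\<^sup>+\<omega>. \<Psi> k \<omega> \<partial>M) \<le> ennreal (sqrt (2 * real N))"
        using \<Psi>_int[of k] by (meson ennreal_leI order_trans)
    qed simp
    also have "\<dots> = ennreal (real (card K) * (c * sqrt (2 * real N)))"
      using c by (simp add: ennreal_mult ennreal_of_nat_eq_real_of_nat)
    also have "card K = (N + 1) ^ card S"
      unfolding K_def using fin by (simp add: card_PiE)
    finally show "(\<integral>\<^sup>+\<omega>. \<Theta> \<omega> \<partial>M)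
        \<le> ennreal (real (N + 1) ^ card S * sqrt (2 * real N) * exp (2 * CARD('d) * card S * T / sqrt N))"
      by (simp add: c_def mult_ac)
  next
    fix \<omega> assume \<omega>: "\<omega> \<in> space M" and "\<forall>s. 0 \<le> s \<and> s < T \<longrightarrow> X s \<omega> \<in> S"
    then have stay: "\<And>s. 0 \<le> s \<Longrightarrow> s < T \<Longrightarrow> X s \<omega> \<in> S" by auto
    have rc: "\<And>t. 0 \<le> t \<Longrightarrow> eventually (\<lambda>s. X s \<omega> = X t \<omega>) (at_right t)"
      using mc \<omega> unfolding markov_chain_def by blast
    define f where "f x = local_time X T \<omega> x / T" for x
    have f0: "0 \<le> f x" for x unfolding f_def using local_time_nonneg[of X T \<omega>] T by simp
    have "(\<Sum>x\<in>S. f x) = 1"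
      using sum_local_time[of T X \<omega>, OF T rc fin stay] T by (simp add: f_def flip: sum_divide_distrib)
    then have f1: "f x \<le> 1" if "x \<in> S" for x
      using member_le_sum[of x S f] that fin f0 by auto
    \<comment> \<open>the cell that contains the profile \<open>f\<close> of this path\<close>
    define k where "k = restrict (\<lambda>x. nat \<lfloor>N * f x\<rfloor>) S"
    have k: "real (k x) \<le> N * f x" "N * f x < real (k x + 1)" if "x \<in> S" for x
    proof -
      have "real (k x) = of_int \<lfloor>N * f x\<rfloor>" using that f0[of x] by (simp add: k_def)
      then show "real (k x) \<le> N * f x" "N * f x < real (k x + 1)" by linarith+
    qed
    have "k x \<le> N" if "x \<in> S" for x
    proof -
      have "real (k x) \<le> N * f x" by (rule k(1)[OF that])
      also have "\<dots> \<le> real N * 1" using f1[OF that] by (intro mult_left_mono) auto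
      finally show ?thesis by simp
    qed
    then have kK: "k \<in> K" by (auto simp: K_def k_def)
    have "dirichlet_form S f \<le> (\<Sum>x\<in>S. V k x * f x) + 2 * CARD('d) * card S * sqrt (1 / N)"
      unfolding V_def
    proof (rule dirichlet_form_le_potential[OF fin])
      fix x assume x: "x \<in> S"
      have u2: "(u k x)\<^sup>2 = real (k x + 1) / N" by (simp add: u_def)
      show "f x \<le> (u k x)\<^sup>2" "(u k x)\<^sup>2 \<le> f x + 1 / N"
        unfolding u2 using k[OF x] N by (simp_all add: field_simps)
      show "0 < u k x" using N by (simp add: u_def)
    qed (use f0 f1 in auto)
    then have "T * dirichlet_form S f \<le> T * ((\<Sum>x\<in>S. V k x * f x) + 2 * CARD('d) * card S * sqrt (1 / N))"
      using T by (intro mult_left_mono) auto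
    also have "\<dots> = (\<Sum>x\<in>S. V k x * local_time X T \<omega> x) + 2 * CARD('d) * card S * T / sqrt N"
      using T by (simp add: f_def distrib_left sum_distrib_left real_sqrt_divide mult_ac)
    finally have "exp (T * dirichlet_form S f) \<le> c * exp (\<Sum>x\<in>S. V k x * local_time X T \<omega> x)"
      unfolding c_def exp_add[symmetric] by simp
    then have "ennreal (exp (T * dirichlet_form S f)) \<le> ennreal c * \<Psi> k \<omega>"
      using c \<Psi>_path[OF \<omega> stay, of k] by (simp add: ennreal_mult'[symmetric] ennreal_leI)
    also have "\<dots> \<le> \<Theta> \<omega>"
      unfolding \<Theta>_def by (rule member_le_sum[OF kK]) (use finK in auto)
    finally show "ennreal (exp (T * dirichlet_form S (\<lambda>x. local_time X T \<omega> x / T))) \<le> \<Theta> \<omega>"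
      unfolding f_def .
  qed
qed

section \<open>From the discrete variational problem to the expectation\<close>

lemma lattice_box_eq:
  "(lattice_box r :: (int ^ 'd) set) = vec_lambda ` (UNIV \<rightarrow>\<^sub>E {- \<lfloor>r\<rfloor>..\<lfloor>r\<rfloor>})" (is "_ = ?B")
proof
  show "lattice_box r \<subseteq> ?B"
  proof
    fix x :: "int ^ 'd" assume "x \<in> lattice_box r"
    then have "x $ i \<in> {- \<lfloor>r\<rfloor>..\<lfloor>r\<rfloor>}" for i
      by (auto simp: lattice_box_def le_floor_iff minus_le_iff[of "\<lfloor>r\<rfloor>"] minus_le_iff[of r])
    then show "x \<in> ?B"
      by (intro image_eqI[of _ _ "\<lambda>i. x $ i"]) (auto simp: vec_eq_iff)
  qed
  show "?B \<subseteq> lattice_box r"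
    by (auto simp: lattice_box_def PiE_iff le_floor_iff minus_le_iff[of "\<lfloor>r\<rfloor>"] minus_le_iff[of r])
qed

lemma finite_lattice_box: "finite (lattice_box r)"
  unfolding lattice_box_eq by (intro finite_imageI finite_PiE) auto

lemma card_lattice_box_le:
  assumes "0 \<le> r"
  shows "real (card (lattice_box r :: (int ^ 'd) set)) \<le> (2 * r + 1) ^ CARD('d)"
proof -
  have "card (lattice_box r :: (int ^ 'd) set) \<le> card ((UNIV :: 'd set) \<rightarrow>\<^sub>E {- \<lfloor>r\<rfloor>..\<lfloor>r\<rfloor>})"
    unfolding lattice_box_eq by (intro card_image_le finite_PiE) auto
  also have "\<dots> = nat (2 * \<lfloor>r\<rfloor> + 1) ^ CARD('d)"
    by (simp add: card_PiE)
  finally have "real (card (lattice_box r :: (int ^ 'd) set)) \<le> real (nat (2 * \<lfloor>r\<rfloor> + 1)) ^ CARD('d)"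
    by (metis of_nat_le_iff of_nat_power)
  also have "\<dots> \<le> (2 * r + 1) ^ CARD('d)"
  proof (rule power_mono)
    have "real (nat (2 * \<lfloor>r\<rfloor> + 1)) = 2 * of_int \<lfloor>r\<rfloor> + 1" using assms by simp
    then show "real (nat (2 * \<lfloor>r\<rfloor> + 1)) \<le> 2 * r + 1" by linarith
  qed simp
  finally show ?thesis .
qed

lemma local_time_supported_in_box:
  fixes X :: "real \<Rightarrow> 'w \<Rightarrow> int ^ 'd"
  assumes a: "0 < a" and T: "0 < T"
    and supp: "supp (rescaled_local_time X a T \<omega>) \<subseteq> cube R"
    and z: "local_time X T \<omega> z \<noteq> 0"
  shows "z \<in> lattice_box (R * a)"
proof -
  \<comment> \<open>the corner of the cell of side \<open>1 / a\<close> on which the rescaled local time takes the value from \<open>z\<close>\<close>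
  define x :: "real ^ 'd" where "x = (\<chi> i. real_of_int (z $ i) / a)"
  have "lattice_floor (a *\<^sub>R x) = z"
    using a by (simp add: lattice_floor_def x_def vec_eq_iff)
  then have "rescaled_local_time X a T \<omega> x \<noteq> 0"
    using a T z by (simp add: rescaled_local_time_def)
  then have "x \<in> supp (rescaled_local_time X a T \<omega>)"
    unfolding supp_def by (intro closure_subset[THEN subsetD]) simp
  then have "x \<in> cube R" using supp by auto
  then show ?thesis
    using a by (auto simp: cube_def lattice_box_def x_def pos_divide_le_eq pos_le_divide_eq mult_ac)
qed

text \<open>
  On the event in question the normalised local times are an admissible \<open>\<mu>\<close> for the discrete problem,
  and \<open>step_density a \<mu>\<close> is the rescaled local time. Hence \<open>F\<close> of it is at most the energy of \<open>\<mu>\<close>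
  times \<open>a\<^sup>2\<close>, minus \<open>c\<close>, for each path separately, and the exponential moment of the energy is already
  controlled.
\<close>

lemma expectation_bound:
  fixes X :: "real \<Rightarrow> 'w \<Rightarrow> int ^ 'd" and F :: "(real ^ 'd \<Rightarrow> real) \<Rightarrow> real"
    and R a T c :: real
  assumes walk: "simple_random_walk M X"
    and R: "0 < R" and a: "0 < a" and T: "0 < T" and N: "1 \<le> (N::nat)"
    and c: "ereal c \<le> discrete_rate R a F"
  shows "(\<integral>\<^sup>+\<omega>. ennreal
             (exp (T / a\<^sup>2 * F (rescaled_local_time X a T \<omega>)) *
              indicator {\<omega>. supp (rescaled_local_time X a T \<omega>) \<subseteq> cube R} \<omega>) \<partial>M)
    \<le> ennreal (exp (- c * (T / a\<^sup>2)) * (real (N + 1) ^ card (lattice_box (R * a) :: (int ^ 'd) set) * sqrt (2 * real N) *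
         exp (2 * CARD('d) * card (lattice_box (R * a) :: (int ^ 'd) set) * T / sqrt N)))"
proof -
  define S :: "(int ^ 'd) set" where "S = lattice_box (R * a)"
  have fin: "finite S" unfolding S_def by (rule finite_lattice_box)
  have S0: "0 \<in> S" using R a by (auto simp: S_def lattice_box_def)
  obtain \<Psi> where [measurable]: "\<Psi> \<in> borel_measurable M"
    and \<Psi>_int: "(\<integral>\<^sup>+\<omega>. \<Psi> \<omega> \<partial>M) \<le> ennreal (real (N + 1) ^ card S * sqrt (2 * real N) * exp (2 * CARD('d) * card S * T / sqrt N))"
    and \<Psi>: "\<And>\<omega>. \<omega> \<in> space M \<Longrightarrow> (\<And>s. 0 \<le> s \<Longrightarrow> s < T \<Longrightarrow> X s \<omega> \<in> S) \<Longrightarrow>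
       ennreal (exp (T * dirichlet_form S (\<lambda>x. local_time X T \<omega> x / T))) \<le> \<Psi> \<omega>"
    using exponential_energy_bound[OF walk fin S0 T N] by blast
  have "(\<integral>\<^sup>+\<omega>. ennreal
             (exp (T / a\<^sup>2 * F (rescaled_local_time X a T \<omega>)) *
              indicator {\<omega>. supp (rescaled_local_time X a T \<omega>) \<subseteq> cube R} \<omega>) \<partial>M)
     \<le> (\<integral>\<^sup>+\<omega>. ennreal (exp (- c * (T / a\<^sup>2))) * \<Psi> \<omega> \<partial>M)"
  proof (rule nn_integral_mono)
    fix \<omega> assume \<omega>: "\<omega> \<in> space M"
    show "ennreal (exp (T / a\<^sup>2 * F (rescaled_local_time X a T \<omega>)) *
              indicator {\<omega>. supp (rescaled_local_time X a T \<omega>) \<subseteq> cube R} \<omega>)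
        \<le> ennreal (exp (- c * (T / a\<^sup>2))) * \<Psi> \<omega>"
    proof (cases "supp (rescaled_local_time X a T \<omega>) \<subseteq> cube R")
      case True
      have rc: "\<And>t. 0 \<le> t \<Longrightarrow> eventually (\<lambda>s. X s \<omega> = X t \<omega>) (at_right t)"
        using walk \<omega> unfolding simple_random_walk_def markov_chain_def by blast
      have out: "local_time X T \<omega> z = 0" if "z \<notin> S" for z
        using local_time_supported_in_box[OF a T True] that unfolding S_def by blast
      have stay: "X s \<omega> \<in> S" if "0 \<le> s" "s < T" for s
        using local_time_pos[of s T X \<omega>, OF that rc] out[of "X s \<omega>"] by force
      define f where "f x = local_time X T \<omega> x / T" for x
      have f0: "0 \<le> f x" for x
        unfolding f_def using local_time_nonneg[of X T \<omega>] T by simp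
      have "(\<Sum>x\<in>S. f x) = 1"
        using sum_local_time[of T X \<omega>, OF T rc fin stay] T by (simp add: f_def flip: sum_divide_distrib)
      then have "(\<integral>\<^sup>+x. ennreal (f x) \<partial>count_space UNIV) = 1"
        using fin f0 out
        by (subst nn_integral_count_space'[of S]) (auto simp: f_def)
      then have pmf_f: "pmf (embed_pmf f) x = f x" for x
        using f0 by (intro pmf_embed_pmf) auto
      define \<mu> where "\<mu> = embed_pmf f"
      have \<mu>: "pmf \<mu> = f" by (auto simp: \<mu>_def pmf_f)
      have step: "step_density a \<mu> = rescaled_local_time X a T \<omega>"
        by (auto simp: step_density_def rescaled_local_time_def \<mu> f_def)
      have f_out: "f x = 0" if "x \<notin> S" for x
        using out[OF that] by (simp add: f_def)
      have \<mu>S: "set_pmf \<mu> \<subseteq> S"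
        using f_out unfolding set_eq_iff set_pmf_iff \<mu> by (metis set_pmf_iff \<mu> subsetI)
      have "discrete_rate R a F \<le> ereal (a\<^sup>2 * discrete_energy \<mu> - F (step_density a \<mu>))"
        unfolding discrete_rate_def by (rule INF_lower) (use \<mu>S True in \<open>auto simp: S_def step\<close>)
      with c have "ereal c \<le> ereal (a\<^sup>2 * discrete_energy \<mu> - F (step_density a \<mu>))"
        by (rule order_trans)
      then have "c \<le> a\<^sup>2 * discrete_energy \<mu> - F (rescaled_local_time X a T \<omega>)"
        by (simp add: step)
      also have "\<dots> \<le> a\<^sup>2 * dirichlet_form S f - F (rescaled_local_time X a T \<omega>)"
        using discrete_energy_le_dirichlet_form[OF fin \<mu>S] unfolding \<mu>
        by (intro diff_right_mono mult_left_mono) auto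
      finally have "F (rescaled_local_time X a T \<omega>) \<le> a\<^sup>2 * dirichlet_form S f - c" by simp
      then have "T / a\<^sup>2 * F (rescaled_local_time X a T \<omega>) \<le> T / a\<^sup>2 * (a\<^sup>2 * dirichlet_form S f - c)"
        using T by (intro mult_left_mono) auto
      also have "\<dots> = - c * (T / a\<^sup>2) + T * dirichlet_form S f"
        using a by (simp add: field_simps)
      finally have "exp (T / a\<^sup>2 * F (rescaled_local_time X a T \<omega>))
          \<le> exp (- c * (T / a\<^sup>2)) * exp (T * dirichlet_form S f)"
        unfolding exp_add[symmetric] by simp
      then have "ennreal (exp (T / a\<^sup>2 * F (rescaled_local_time X a T \<omega>)))
          \<le> ennreal (exp (- c * (T / a\<^sup>2))) * ennreal (exp (T * dirichlet_form S f))"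
        by (simp add: ennreal_mult[symmetric] ennreal_leI)
      also have "\<dots> \<le> ennreal (exp (- c * (T / a\<^sup>2))) * \<Psi> \<omega>"
        using \<Psi>[OF \<omega> stay] unfolding f_def[abs_def] by (intro mult_left_mono) auto
      finally show ?thesis using True by simp
    qed simp
  qed
  also have "\<dots> = ennreal (exp (- c * (T / a\<^sup>2))) * (\<integral>\<^sup>+\<omega>. \<Psi> \<omega> \<partial>M)"
    by (rule nn_integral_cmult) measurable
  also have "\<dots> \<le> ennreal (exp (- c * (T / a\<^sup>2))) *
      ennreal (real (N + 1) ^ card S * sqrt (2 * real N) * exp (2 * CARD('d) * card S * T / sqrt N))"
    by (intro mult_left_mono \<Psi>_int) auto
  finally show ?thesis
    by (simp only: S_def ennreal_mult'[symmetric] exp_ge_zero)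
qed

section \<open>Asymptotics\<close>

lemma log_ennreal_le:
  assumes "x \<le> ennreal b" and "0 < b"
  shows "log_ennreal x \<le> ereal (ln b)"
proof (cases x)
  case (real r)
  then show ?thesis using assms by (auto simp: log_ennreal_def ennreal_eq_0_iff enn2real_ennreal)
next
  case top
  then show ?thesis using assms by (simp add: top_unique)
qed

text \<open>
  The upper bound on the scale enters only here: after multiplication by \<open>\<alpha>\<^sup>2 / T\<close>, the error
  \<open>\<alpha> ^ d * ln T\<close> in the logarithm vanishes.
\<close>

lemma scale_power_log_tendsto_0:
  fixes \<alpha> :: "real \<Rightarrow> real" and d :: nat
  assumes upper: "much_less \<alpha> (\<lambda>T. (T / ln T) powr (1 / (real d + 2)))"
  shows "((\<lambda>T. \<alpha> T ^ (d + 2) * ln T / T) \<longlongrightarrow> 0) at_top"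
proof -
  have "((\<lambda>T. (\<alpha> T / (T / ln T) powr (1 / (real d + 2))) ^ (d + 2)) \<longlongrightarrow> 0 ^ (d + 2)) at_top"
    using upper unfolding much_less_def by (rule tendsto_power)
  moreover have "eventually (\<lambda>T. (\<alpha> T / (T / ln T) powr (1 / (real d + 2))) ^ (d + 2)
      = \<alpha> T ^ (d + 2) * ln T / T) at_top"
    using eventually_gt_at_top[of 1]
  proof eventually_elim
    case (elim T)
    then have "0 < T / ln T" by simp
    then have "((T / ln T) powr (1 / (real d + 2))) ^ (d + 2) = (T / ln T) powr ((1 / (real d + 2)) * real (d + 2))"
      by (subst powr_realpow[symmetric]) (auto simp: powr_powr)
    also have "(1 / (real d + 2)) * real (d + 2) = 1" by (simp add: add.commute)
    finally have "((T / ln T) powr (1 / (real d + 2))) ^ (d + 2) = T / ln T"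
      using \<open>0 < T / ln T\<close> by (simp only: powr_one)
    then show ?case by (simp only: power_divide divide_divide_eq_right)
  qed
  ultimately show ?thesis by (auto intro: Lim_transform_eventually)
qed

text \<open>
  The logarithm of the error factors when \<open>N\<close> is of order \<open>T\<^sup>2\<close>. This choice makes \<open>T / sqrt N \<le> 1\<close>
  while \<open>ln N\<close> is still of order \<open>ln T\<close>; every term is then at most a constant times
  \<open>a ^ d * ln T\<close>.
\<close>

lemma log_correction_le:
  fixes d :: nat and a T R :: real
  assumes R: "0 < R" and a: "1 \<le> a" and T: "3 \<le> T" and m: "real m \<le> (2 * (R * a) + 1) ^ d"
    and N: "N = nat \<lceil>T\<rceil> ^ 2"
  shows "m * ln (real (N + 1)) + ln (2 * real N) / 2 + 2 * d * m * T / sqrt N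
     \<le> (5 * (2 * R + 1) ^ d + 5 + 2 * d * (2 * R + 1) ^ d) * (a ^ d * ln T)"
proof -
  define K where "K = (2 * R + 1) ^ d"
  have K: "0 \<le> K" using R by (simp add: K_def)
  have "(2 * (R * a) + 1) ^ d \<le> ((2 * R + 1) * a) ^ d"
    using R a by (intro power_mono) (auto simp: algebra_simps)
  then have m': "real m \<le> K * a ^ d" using m by (simp add: K_def power_mult_distrib)
  have ad: "1 \<le> a ^ d" using a by simp
  have "exp 1 \<le> T" using exp_le T by linarith
  then have lnT: "1 \<le> ln T" using T by (subst ln_ge_iff) auto
  have "real (nat \<lceil>T\<rceil>) = of_int \<lceil>T\<rceil>" using T by simp
  then have c: "T \<le> real (nat \<lceil>T\<rceil>)" "real (nat \<lceil>T\<rceil>) \<le> 2 * T" using T by linarith+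
  have sqrtN: "T \<le> sqrt N" using c T by (simp add: N)
  have N_ge: "1 \<le> real N"
    using c T by (simp add: N)
  have "real N \<le> (2 * T) ^ 2" unfolding N of_nat_power using c T by (intro power_mono) auto
  then have "2 * real N \<le> 8 * T ^ 2" by (simp add: power_mult_distrib)
  also have "\<dots> \<le> T ^ 3 * T ^ 2"
    using power_mono[of 3 T 3] T by (intro mult_right_mono) auto
  also have "\<dots> = T ^ 5" by (simp add: power_add[symmetric])
  finally have N5: "2 * real N \<le> T ^ 5" .
  have ln2N: "ln (2 * real N) \<le> 5 * ln T"
  proof -
    have "ln (2 * real N) \<le> ln (T ^ 5)" using N5 N_ge T by (subst ln_le_cancel_iff) auto
    also have "\<dots> = 5 * ln T" using T by (simp add: ln_realpow)
    finally show ?thesis .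
  qed
  have lnN1: "ln (real (N + 1)) \<le> 5 * ln T"
  proof -
    have "ln (real (N + 1)) \<le> ln (2 * real N)" using N_ge by (subst ln_le_cancel_iff) auto
    then show ?thesis using ln2N by simp
  qed
  have "m * ln (real (N + 1)) \<le> (K * a ^ d) * (5 * ln T)"
    using m' lnN1 lnT K ad by (intro mult_mono) auto
  moreover have "ln (2 * real N) / 2 \<le> 5 * (a ^ d * ln T)"
  proof -
    have "ln T \<le> a ^ d * ln T" using ad lnT by (simp add: mult_le_cancel_right1)
    then show ?thesis using ln2N lnT by linarith
  qed
  moreover have "2 * d * m * T / sqrt N \<le> 2 * d * K * (a ^ d * ln T)"
  proof -
    have "2 * d * m * T / sqrt N = 2 * d * m * (T / sqrt N)" by simp
    also have "\<dots> \<le> real (2 * d * m) * 1"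
      using sqrtN T N_ge by (intro mult_left_mono) (auto simp: divide_le_eq_1)
    also have "\<dots> = 2 * d * (real m * 1)" by simp
    also have "\<dots> \<le> 2 * d * ((K * a ^ d) * ln T)"
      using m' lnT K ad by (intro mult_left_mono mult_mono) auto
    finally show ?thesis by (simp add: mult_ac)
  qed
  ultimately show ?thesis
    unfolding K_def[symmetric] by (simp add: algebra_simps)
qed

theorem theorem3p7:
  fixes M :: "'w measure"
    and X :: "real \<Rightarrow> 'w \<Rightarrow> int ^ 'd"
    and \<alpha> :: "real \<Rightarrow> real"
    and R :: real
    and F :: "(real ^ 'd \<Rightarrow> real) \<Rightarrow> real"
  assumes walk: "simple_random_walk M X"
    and \<alpha>_pos: "\<And>T. 0 < T \<Longrightarrow> 0 < \<alpha> T"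
    and \<alpha>_lower: "much_less (\<lambda>T. 1) \<alpha>"
    and \<alpha>_upper: "much_less \<alpha> (\<lambda>T. (T / ln T) powr (1 / (real CARD('d) + 2)))"
    and R_pos: "0 < R"
    and F_measurable: "F \<in> density_space (cube R) \<rightarrow>\<^sub>M borel"
    and discrete_bound:
      "Liminf at_top (\<lambda>T. discrete_rate R (\<alpha> T) F) \<ge> variational_rate (cube R) F"
  shows "Limsup at_top (\<lambda>T. ereal ((\<alpha> T)\<^sup>2 / T) *
           log_ennreal (\<integral>\<^sup>+\<omega>. ennreal
             (exp (T / (\<alpha> T)\<^sup>2 * F (rescaled_local_time X (\<alpha> T) T \<omega>)) *
              indicator {\<omega>. supp (rescaled_local_time X (\<alpha> T) T \<omega>) \<subseteq> cube R} \<omega>) \<partial>M))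
         \<le> - variational_rate (cube R) F"
    (is "Limsup at_top ?L \<le> - ?\<chi>")
proof -
  define d where "d = CARD('d)"
  define C where "C = 5 * (2 * R + 1) ^ d + 5 + 2 * d * (2 * R + 1) ^ d"
  define e where "e T = C * (\<alpha> T ^ (d + 2) * ln T / T)" for T
  have e0: "(e \<longlongrightarrow> C * 0) at_top"
    unfolding e_def
    by (intro tendsto_mult tendsto_const scale_power_log_tendsto_0) (use \<alpha>_upper in \<open>simp add: d_def\<close>)
  have inv: "eventually (\<lambda>T. 1 / \<alpha> T < 1) at_top"
    using \<alpha>_lower unfolding much_less_def by (rule order_tendstoD) simp
  \<comment> \<open>the level \<open>c\<close> keeps the argument valid when \<open>variational_rate\<close> is infinite\<close>
  have bound: "Limsup at_top ?L \<le> ereal (- c)" if c: "ereal c < ?\<chi>" for c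
  proof -
    have "eventually (\<lambda>T. ereal c < discrete_rate R (\<alpha> T) F) at_top"
      by (rule less_LiminfD[OF less_le_trans[OF c discrete_bound]])
    then have "eventually (\<lambda>T. ?L T \<le> ereal (- c + e T)) at_top"
      using inv eventually_ge_at_top[of 3]
    proof eventually_elim
      case (elim T)
      define a where "a = \<alpha> T"
      have T: "0 < T" using elim by simp
      have a: "0 < a" using \<alpha>_pos[OF T] by (simp add: a_def)
      have a1: "1 \<le> a" using elim(2) a by (simp add: a_def)
      define N where "N = nat \<lceil>T\<rceil> ^ 2"
      have N: "1 \<le> N" using T by (simp add: N_def Suc_le_eq)
      define m where "m = card (lattice_box (R * a) :: (int ^ 'd) set)"
      define b where "b = exp (- c * (T / a\<^sup>2)) *
          (real (N + 1) ^ m * sqrt (2 * real N) * exp (2 * d * m * T / sqrt N))"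
      have b: "0 < b" using N by (simp add: b_def)
      have m: "real m \<le> (2 * (R * a) + 1) ^ d"
        unfolding m_def d_def using R_pos a by (intro card_lattice_box_le) simp
      have ln_b: "ln b = - c * (T / a\<^sup>2) + (m * ln (real (N + 1)) + ln (2 * real N) / 2 + 2 * d * m * T / sqrt N)"
        using N by (simp add: b_def ln_mult ln_realpow ln_sqrt)
      have "?L T \<le> ereal (a\<^sup>2 / T) * ereal (ln b)"
        unfolding a_def[symmetric]
      proof (rule ereal_mult_left_mono)
        show "log_ennreal (\<integral>\<^sup>+\<omega>. ennreal
             (exp (T / a\<^sup>2 * F (rescaled_local_time X a T \<omega>)) *
              indicator {\<omega>. supp (rescaled_local_time X a T \<omega>) \<subseteq> cube R} \<omega>) \<partial>M) \<le> ereal (ln b)"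
          unfolding b_def m_def d_def
          by (rule log_ennreal_le[OF expectation_bound[OF walk R_pos a T N]])
             (use elim(1) b in \<open>auto simp: a_def b_def m_def d_def less_imp_le\<close>)
      qed (use T in simp)
      also have "\<dots> = ereal (a\<^sup>2 / T * ln b)" by simp
      also have "a\<^sup>2 / T * ln b \<le> a\<^sup>2 / T * (- c * (T / a\<^sup>2) + C * (a ^ d * ln T))"
        unfolding ln_b C_def using T R_pos a1 elim(3) m
        by (intro mult_left_mono add_left_mono log_correction_le) (auto simp: N_def)
      also have "\<dots> = - c + e T"
        using a T by (simp add: e_def a_def[symmetric] field_simps power_add power2_eq_square)
      finally show ?case by simp
    qed
    then have "Limsup at_top ?L \<le> Limsup at_top (\<lambda>T. ereal (- c + e T))"
      by (rule Limsup_mono)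
    also have "((\<lambda>T. ereal (- c + e T)) \<longlongrightarrow> ereal (- c + C * 0)) at_top"
      using e0 by (intro tendsto_ereal tendsto_add tendsto_const)
    then have "Limsup at_top (\<lambda>T. ereal (- c + e T)) = ereal (- c)"
      by (intro lim_imp_Limsup) auto
    finally show ?thesis .
  qed
  have "?\<chi> \<le> - Limsup at_top ?L"
  proof (rule ccontr)
    assume "\<not> ?\<chi> \<le> - Limsup at_top ?L"
    then obtain c where "- Limsup at_top ?L < ereal c" "ereal c < ?\<chi>"
      using ereal_dense2[of "- Limsup at_top ?L" ?\<chi>] by (auto simp: not_le)
    then show False using bound[of c] by (simp add: ereal_uminus_less_reorder)
  qed
  then have "- (- Limsup at_top ?L) \<le> - ?\<chi>" by (simp only: ereal_minus_le_minus)
  then show ?thesis by (simp only: ereal_uminus_uminus)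
qed

end
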